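(* For every constant $\alpha\ge1$ there exists a Weighing Scale alternative $(X,c)$ whose MDP $\mathcal M$ admits no commitment that is an $\alpha$-pointwise approximation for $\mathcal M$.
   Context: A WS alternative $(X,c)$: $X\ge0$ random with known distribution, weighing cost $c\ge0$. Its costly information MDP $\mathcal M$: in a state representing the current conditional distribution of $X$, one may weigh against a threshold $t$ (cost $c$), moving to the state for $X\mid X\le t$ or $X\mid X>t$, or stop weighing (cost $0$), moving to a terminal state whose value is the current conditional expectation of $X$. A commitment $\pi$ fixes in advance a (possibly randomized) weighing protocol; $\mathcal M^\pi$ is the resulting Markov chain. For an MDP $\mathcal N$ and $y\in\mathbb R$, in the local game $(\mathcal N,y)$ a policy advances $\mathcal N$ (paying costs) and finally accepts either an outside option of cost $y$ or a terminal state of $\mathcal N$; $f_{\mathcal N}(y)$ is its minimum expected total cost, and $W^*_{\mathcal N}$ is the random variable with $\mathbb E[\min(y,W^*_{\mathcal N})]=f_{\mathcal N}(y)$ for all $y$. For a random variable $Z$ and $q\in[0,1]$, $Z(q)=\inf\{x:\Pr[Z\le x]\ge q\}$. A commitment $\pi$ is an $\alpha$-pointwise approximation for $\mathcal M$ if $W^*_{\mathcal M^\pi}(q)\le\alpha W^*_{\mathcal M}(q)$ for all $q\in[0,1]$. *)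

theory Defs
  imports "HOL-Probability.Probability"
begin

text \<open>
  Every action of type \<open>'a\<close> is available in every non-terminal state. A Markov chain is the special
  case \<open>'a = unit\<close>. Transition measures at terminal states are never used.
\<close>

record ('s, 'a) mdp =
  state_space :: "'s measure"
  action_space :: "'a measure"
  initial :: 's
  terminal :: "'s set"
  val :: "'s \<Rightarrow> real"
  action_cost :: "'s \<Rightarrow> 'a \<Rightarrow> real"
  trans :: "'s \<Rightarrow> 'a \<Rightarrow> 's measure"

text \<open>
  A policy of the local game is a well-founded decision tree, so it is history dependent and always
  comes to a decision; the tree need not have bounded depth. \<open>Advance a k\<close> plays \<open>a\<close> and goes on
  with \<open>k s'\<close> once the next state \<open>s'\<close> has been observed.
\<close>

datatype ('s, 'a) policy =
    Take_Outside
  | Accept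
  | Advance 'a "'s \<Rightarrow> ('s, 'a) policy"

primrec total_cost ::
  "('s, 'a) mdp \<Rightarrow> real \<Rightarrow> ('s, 'a) policy \<Rightarrow> 's \<Rightarrow> real"
where
  "total_cost N y Take_Outside s = y"
| "total_cost N y Accept s = val N s"
| "total_cost N y (Advance a k) s =
     action_cost N s a + (\<integral>s'. total_cost N y (k s') s' \<partial>trans N s a)"

text \<open>
  The integrability requirement excludes policies that are not measurable or have infinite expected
  cost; without it the Bochner integral would give such policies the spurious value 0.
\<close>

primrec admissible :: "('s, 'a) mdp \<Rightarrow> ('s, 'a) policy \<Rightarrow> 's \<Rightarrow> bool" where
  "admissible N Take_Outside s \<longleftrightarrow> True"
| "admissible N Accept s \<longleftrightarrow> s \<in> terminal N"
| "admissible N (Advance a k) s \<longleftrightarrow>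
     s \<notin> terminal N \<and> (\<forall>s'. admissible N (k s') s') \<and>
     (\<forall>y. integrable (trans N s a) (\<lambda>s'. total_cost N y (k s') s'))"

definition local_value :: "('s, 'a) mdp \<Rightarrow> real \<Rightarrow> real" where
  "local_value N y =
     (INF p\<in>{p. admissible N p (initial N)}. total_cost N y p (initial N))"

text \<open>
  \<open>W\<^sup>*\<close> is represented by its law on the extended reals: if a Markov chain fails to reach a terminal
  state with positive probability, then \<open>W\<^sup>* = \<infinity>\<close> with that probability. The defining equation at
  negative \<open>y\<close> rules out mass at \<open>-\<infinity>\<close>, so the value of \<open>real_of_ereal\<close> there is irrelevant.
\<close>

definition is_W_law :: "('s, 'a) mdp \<Rightarrow> ereal measure \<Rightarrow> bool" where
  "is_W_law N W \<longleftrightarrow>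
     prob_space W \<and> sets W = sets borel \<and>
     (\<forall>y::real. has_bochner_integral W (\<lambda>w. real_of_ereal (min (ereal y) w)) (local_value N y))"

definition W_law :: "('s, 'a) mdp \<Rightarrow> ereal measure" where
  "W_law N = (THE W. is_W_law N W)"

definition quantile :: "ereal measure \<Rightarrow> real \<Rightarrow> ereal" where
  "quantile W q = Inf {x. q \<le> measure W {..x}}"

definition commitment :: "('s, 'a) mdp \<Rightarrow> ('s \<Rightarrow> 'a measure) \<Rightarrow> bool" where
  "commitment N \<pi> \<longleftrightarrow> \<pi> \<in> state_space N \<rightarrow>\<^sub>M prob_algebra (action_space N)"

definition committed_chain ::
  "('s, 'a) mdp \<Rightarrow> ('s \<Rightarrow> 'a measure) \<Rightarrow> ('s, unit) mdp"
where
  "committed_chain N \<pi> =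
     \<lparr> state_space = state_space N,
       action_space = count_space UNIV,
       initial = initial N,
       terminal = terminal N,
       val = val N,
       action_cost = (\<lambda>s _. \<integral>a. action_cost N s a \<partial>\<pi> s),
       trans = (\<lambda>s _. \<pi> s \<bind> trans N s) \<rparr>"

definition pointwise_approximation ::
  "real \<Rightarrow> ('s, 'a) mdp \<Rightarrow> ('s \<Rightarrow> 'a measure) \<Rightarrow> bool"
where
  "pointwise_approximation \<alpha> N \<pi> \<longleftrightarrow>
     (\<forall>q\<in>{0..1}. quantile (W_law (committed_chain N \<pi>)) q \<le> ereal \<alpha> * quantile (W_law N) q)"

text \<open>
  An alternative \<open>(X, c)\<close> is given by the law \<open>D\<close> of \<open>X\<close>. Finiteness of the mean is needed for
  the terminal values to be finite.
\<close>

definition ws_alternative :: "real measure \<Rightarrow> real \<Rightarrow> bool" where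
  "ws_alternative D c \<longleftrightarrow>
     prob_space D \<and> sets D = sets borel \<and> (AE x in D. 0 \<le> x) \<and> integrable D (\<lambda>x. x) \<and> 0 \<le> c"

text \<open>
  A non-terminal state represents the current conditional distribution of \<open>X\<close> by the list of the
  weighings made so far, oldest first: an entry \<open>(t, b)\<close> says that \<open>X\<close> was weighed against \<open>t\<close> and
  that the answer to \<open>X \<le> t\<close> was \<open>b\<close>. A commitment may therefore depend on the whole history and not
  just on the conditional distribution.
\<close>

type_synonym history = "(real \<times> bool) list"

definition conditional :: "real measure \<Rightarrow> history \<Rightarrow> real measure" where
  "conditional D h = uniform_measure D {x. \<forall>(t, b)\<in>set h. (x \<le> t) = b}"

text \<open>
  On the lists of any fixed length \<open>n\<close> this is the \<open>n\<close>-fold product \<open>\<sigma>\<close>-algebra.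
\<close>

definition history_space :: "history measure" where
  "history_space =
     vimage_algebra UNIV (\<lambda>h. (length h, \<lambda>i. if i < length h then h ! i else (0, False)))
       (count_space UNIV \<Otimes>\<^sub>M (\<Pi>\<^sub>M i\<in>UNIV. borel \<Otimes>\<^sub>M count_space UNIV))"

datatype ws_action = Stop | Weigh real

definition ws_action_space :: "ws_action measure" where
  "ws_action_space = sigma UNIV {A. Weigh -` A \<in> sets borel}"

text \<open>
  The second component of a state says whether weighing has been stopped. Weighing against \<open>t\<close> in
  history \<open>h\<close> reveals whether \<open>x \<le> t\<close> for an \<open>x\<close> drawn from the current conditional distribution.
\<close>

definition ws_state_space :: "(history \<times> bool) measure" where
  "ws_state_space = history_space \<Otimes>\<^sub>M count_space UNIV"

primrec ws_cost :: "real \<Rightarrow> ws_action \<Rightarrow> real" where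
  "ws_cost c Stop = 0"
| "ws_cost c (Weigh t) = c"

primrec ws_trans :: "real measure \<Rightarrow> history \<Rightarrow> ws_action \<Rightarrow> (history \<times> bool) measure" where
  "ws_trans D h Stop = return ws_state_space (h, True)"
| "ws_trans D h (Weigh t) =
     distr (conditional D h) ws_state_space (\<lambda>x. (h @ [(t, x \<le> t)], False))"

definition ws_mdp :: "real measure \<Rightarrow> real \<Rightarrow> (history \<times> bool, ws_action) mdp" where
  "ws_mdp D c =
     \<lparr> state_space = ws_state_space,
       action_space = ws_action_space,
       initial = ([], False),
       terminal = {s. snd s},
       val = (\<lambda>s. \<integral>x. x \<partial>conditional D (fst s)),
       action_cost = (\<lambda>s. ws_cost c),
       trans = (\<lambda>s. ws_trans D (fst s)) \<rparr>"

end

theory Submission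
  imports Defs
begin

text \<open>
  The local value \<open>f\<close> determines \<open>W\<^sup>*\<close> through its slopes, \<open>f'(y) = Pr[W\<^sup>* > y]\<close>, so a pointwise
  approximation bounds the slopes of the local value of the committed chain.

  Let \<open>X\<close> take the values \<open>R ^ i\<close> for \<open>i \<le> N + 1\<close> with tails \<open>Pr[X \<ge> R ^ k]\<close> of order \<open>R ^ (- k)\<close>, and
  let weighing cost 1. For the outside option of cost \<open>y\<close> the best policy weighs once, against \<open>y\<close>,
  which gives \<open>f(y) = min (min y (E X)) (1 + E (min X y))\<close> and
  \<open>Pr[W\<^sup>* > 4 * R ^ k] \<le> Pr[X \<ge> R ^ (k + 1)]\<close>; this probability is even 0 for \<open>k = N\<close>.
  A commitment, on the other hand, ends on the path of the largest value of \<open>X\<close> in a state that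
  merely says \<open>X \<ge> R ^ j\<close>, for some possibly random \<open>j\<close>. If \<open>j = k\<close>, the conditional mean is at least
  \<open>6 * \<alpha> * R ^ k\<close>, so that the outside option \<open>6 * \<alpha> * R ^ k\<close> would be taken there, and the bound on
  the slope shows that \<open>j = k\<close> has probability at most \<open>Pr[X \<ge> R ^ (k + 1)] / Pr[X \<ge> R ^ k] \<le> 1 / R\<close>,
  and probability 0 if \<open>k \<ge> N\<close>. As \<open>N < R\<close>, these probabilities cannot add up to 1.
\<close>

section \<open>Laws of surrogate values\<close>

text \<open>Stated for an arbitrary function \<open>f\<close>, so that existence and uniqueness can
  be settled for concave functions without reference to an MDP.\<close>

definition has_W_law :: "(real \<Rightarrow> real) \<Rightarrow> ereal measure \<Rightarrow> bool" where
  "has_W_law f W \<longleftrightarrow>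
     prob_space W \<and> sets W = sets borel \<and>
     (\<forall>y::real. has_bochner_integral W (\<lambda>w. real_of_ereal (min (ereal y) w)) (f y))"

lemma is_W_law_iff: "is_W_law N W \<longleftrightarrow> has_W_law (local_value N) W"
  by (simp add: is_W_law_def has_W_law_def)

text \<open>This bound and the next one survive infinite \<open>w\<close>: at
  \<open>\<infinity>\<close> the two minima are \<open>z\<close> and \<open>y\<close>, and at
  \<open>-\<infinity>\<close> \<open>real_of_ereal\<close> turns both into 0.\<close>

lemma real_min_diff_le:
  assumes "y \<le> z"
  shows "real_of_ereal (min (ereal z) w) - real_of_ereal (min (ereal y) w)
    \<le> (z - y) * indicator {ereal y<..} w"
  using assms by (cases w) (auto simp: indicator_def min_def)

lemma real_min_diff_ge:
  assumes "y \<le> z"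
  shows "(z - y) * indicator {ereal z..} w
    \<le> real_of_ereal (min (ereal z) w) - real_of_ereal (min (ereal y) w)"
  using assms by (cases w) (auto simp: indicator_def min_def)

context
  fixes f :: "real \<Rightarrow> real" and W :: "ereal measure"
  assumes law: "has_W_law f W"
begin

text \<open>Integrating the pointwise bounds squeezes the slope of \<open>f\<close> over
  \<open>[y, z]\<close> between \<open>Pr[W >= z]\<close> and \<open>Pr[W > y]\<close>.\<close>

lemma has_W_law_diff_le:
  assumes "y \<le> z"
  shows "f z - f y \<le> (z - y) * measure W {ereal y<..}"
proof -
  interpret prob_space W using law by (simp add: has_W_law_def)
  have sets[measurable_cong]: "sets W = sets borel" using law by (simp add: has_W_law_def)
  have bi: "has_bochner_integral W
      (\<lambda>w. real_of_ereal (min (ereal z) w) - real_of_ereal (min (ereal y) w)) (f z - f y)"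
    using law by (intro has_bochner_integral_diff) (auto simp: has_W_law_def)
  have "f z - f y \<le> (\<integral>w. (z - y) * indicator {ereal y<..} w \<partial>W)"
    unfolding has_bochner_integral_integral_eq[OF bi, symmetric]
    using bi real_min_diff_le[OF assms]
    by (intro integral_mono integrable_mult_right integrable_real_indicator)
       (auto simp: has_bochner_integral_iff sets emeasure_eq_measure)
  also have "\<dots> = (z - y) * measure W {ereal y<..}"
    by simp
  finally show ?thesis .
qed

lemma has_W_law_diff_ge:
  assumes "y \<le> z"
  shows "(z - y) * measure W {ereal z..} \<le> f z - f y"
proof -
  interpret prob_space W using law by (simp add: has_W_law_def)
  have sets[measurable_cong]: "sets W = sets borel" using law by (simp add: has_W_law_def)
  have bi: "has_bochner_integral W
      (\<lambda>w. real_of_ereal (min (ereal z) w) - real_of_ereal (min (ereal y) w)) (f z - f y)"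
    using law by (intro has_bochner_integral_diff) (auto simp: has_W_law_def)
  have "(z - y) * measure W {ereal z..} = (\<integral>w. (z - y) * indicator {ereal z..} w \<partial>W)"
    by simp
  also have "\<dots> \<le> f z - f y"
    unfolding has_bochner_integral_integral_eq[OF bi, symmetric]
    using bi real_min_diff_ge[OF assms]
    by (intro integral_mono integrable_mult_right integrable_real_indicator)
       (auto simp: has_bochner_integral_iff sets emeasure_eq_measure)
  finally show ?thesis .
qed

end

text \<open>The slope of the common function \<open>f\<close> on \<open>[t, y]\<close> separates
  \<open>Pr[V >= y]\<close> from \<open>Pr[W > t]\<close>; letting \<open>y\<close> decrease to
  \<open>t\<close> exhausts \<open>{ereal t<..}\<close>.\<close>

lemma has_W_law_tail_le:
  assumes V: "has_W_law f V" and W: "has_W_law f W"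
  shows "measure V {ereal t<..} \<le> measure W {ereal t<..}"
proof -
  interpret prob_space V using V by (simp add: has_W_law_def)
  have sets: "sets V = sets borel" using V by (simp add: has_W_law_def)
  have le: "measure V {ereal y..} \<le> measure W {ereal t<..}" if "t < y" for y
  proof -
    have "(y - t) * measure V {ereal y..} \<le> (y - t) * measure W {ereal t<..}"
      using has_W_law_diff_ge[OF V, of t y] has_W_law_diff_le[OF W, of t y] that by linarith
    then show ?thesis using that by (subst (asm) mult_le_cancel_left_pos) auto
  qed
  have "(\<lambda>n. measure V {ereal (t + 1 / real (Suc n))..})
      \<longlonglongrightarrow> measure V (\<Union>n. {ereal (t + 1 / real (Suc n))..})"
    by (intro finite_Lim_measure_incseq)
       (auto simp: sets incseq_def field_simps intro: order_trans[rotated])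
  also have "(\<Union>n. {ereal (t + 1 / real (Suc n))..}) = {ereal t<..}"
  proof (intro equalityI subsetI)
    fix w assume "w \<in> {ereal t<..}"
    then have "\<exists>n. ereal (t + 1 / real (Suc n)) \<le> w"
    proof (cases w)
      case (real r)
      with \<open>w \<in> _\<close> have "0 < r - t" by simp
      then obtain n where "1 / real (Suc n) < r - t" by (metis nat_approx_posE)
      then show ?thesis using real by (intro exI[of _ n]) simp
    qed auto
    then show "w \<in> (\<Union>n. {ereal (t + 1 / real (Suc n))..})" by auto
  next
    fix w assume "w \<in> (\<Union>n. {ereal (t + 1 / real (Suc n))..})"
    then obtain n where "ereal (t + 1 / real (Suc n)) \<le> w" by auto
    moreover have "ereal t < ereal (t + 1 / real (Suc n))" by simp
    ultimately have "ereal t < w" by (metis less_le_trans)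
    then show "w \<in> {ereal t<..}" by simp
  qed
  finally show ?thesis
    by (rule LIMSEQ_le_const2) (auto intro!: exI[of _ 0] le)
qed

text \<open>By symmetry the tails above finite points agree. The tail above
  \<open>-\<infinity>\<close> is a limit of these, and the half-lines \<open>{..a}\<close> are an
  intersection-stable generator of the Borel sets.\<close>

lemma has_W_law_unique:
  assumes V: "has_W_law f V" and W: "has_W_law f W"
  shows "V = W"
proof -
  interpret V: prob_space V using V by (simp add: has_W_law_def)
  interpret W: prob_space W using W by (simp add: has_W_law_def)
  have sets: "sets V = sets borel" "sets W = sets borel" using V W by (simp_all add: has_W_law_def)
  then have space: "space V = UNIV" "space W = UNIV" by (auto dest: sets_eq_imp_space_eq)
  have tail: "measure V {ereal t<..} = measure W {ereal t<..}" for t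
    using has_W_law_tail_le[OF V W] has_W_law_tail_le[OF W V] by (rule antisym)
  have minf: "measure V {-\<infinity><..} = measure W {-\<infinity><..}"
  proof -
    have Un: "(\<Union>n. {ereal (- real n)<..}) = {-\<infinity><..}"
    proof (intro equalityI subsetI)
      fix w :: ereal assume "w \<in> {-\<infinity><..}"
      then have "\<exists>n. ereal (- real n) < w"
      proof (cases w)
        case (real r)
        obtain n where "- r < real n" using reals_Archimedean2 by blast
        then show ?thesis using real by (intro exI[of _ n]) simp
      qed auto
      then show "w \<in> (\<Union>n. {ereal (- real n)<..})" by auto
    qed (auto intro: less_trans[rotated])
    have "(\<lambda>n. measure V {ereal (- real n)<..}) \<longlonglongrightarrow> measure V {-\<infinity><..}"
      unfolding Un[symmetric]
      by (intro V.finite_Lim_measure_incseq)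
         (auto simp: sets incseq_def intro: le_less_trans[rotated])
    moreover have "(\<lambda>n. measure W {ereal (- real n)<..}) \<longlonglongrightarrow> measure W {-\<infinity><..}"
      unfolding Un[symmetric]
      by (intro W.finite_Lim_measure_incseq)
         (auto simp: sets incseq_def intro: le_less_trans[rotated])
    ultimately show ?thesis using LIMSEQ_unique unfolding tail by blast
  qed
  have Ioi: "measure V {a<..} = measure W {a<..}" for a
    using tail minf by (cases a) (auto simp: greaterThan_def)
  have Iic: "emeasure V {..a} = emeasure W {..a}" for a
  proof -
    have "{..a} = UNIV - {a<..}" by auto
    then show ?thesis
      using V.prob_compl[of "{a<..}"] W.prob_compl[of "{a<..}"] Ioi[of a]
      by (simp add: V.emeasure_eq_measure W.emeasure_eq_measure sets space)
  qed
  have gen: "sets borel = sigma_sets UNIV (range (\<lambda>a::ereal. {..a}))"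
  proof (intro equalityI subsetI)
    fix A :: "ereal set" assume A: "A \<in> sets borel"
    have "(\<lambda>x. x) \<in> borel_measurable (sigma UNIV (range (\<lambda>a::ereal. {..a})))"
      by (subst borel_measurable_iff_Iic_ereal) auto
    from measurable_sets[OF this A] show "A \<in> sigma_sets UNIV (range (\<lambda>a::ereal. {..a}))"
      by simp
  next
    fix A assume "A \<in> sigma_sets UNIV (range (\<lambda>a::ereal. {..a}))"
    then show "A \<in> sets borel"
      by (rule sets.sigma_sets_subset[where M=borel, simplified, THEN subsetD, rotated]) auto
  qed
  show ?thesis
  proof (rule measure_eqI_generator_eq[where E="range (\<lambda>a::ereal. {..a})" and \<Omega>=UNIV and A="\<lambda>_. UNIV"])
    show "Int_stable (range (\<lambda>a::ereal. {..a}))"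
      by (auto simp: Int_stable_def intro!: exI[of _ "min _ _"])
    show "range (\<lambda>_::nat. UNIV) \<subseteq> range (\<lambda>a::ereal. {..a})"
      by (auto intro!: image_eqI[of _ _ \<infinity>])
  qed (use sets gen Iic in auto)
qed

text \<open>The quantile transform of a uniform variable realises the tail function
  \<open>g\<close>, so its truncated expectation \<open>F\<close> obeys the same slope bounds as
  \<open>f\<close>. These bounds and the common value at 0 force \<open>F = f\<close>.\<close>

lemma quantile_function_law:
  fixes f g :: "real \<Rightarrow> real"
  assumes g01: "\<And>y. 0 \<le> g y" "\<And>y. g y \<le> 1"
    and g1: "\<And>y. y < 0 \<Longrightarrow> g y = 1"
    and slope: "\<And>y z. y \<le> z \<Longrightarrow> (z - y) * g z \<le> f z - f y"
      "\<And>y z. y \<le> z \<Longrightarrow> f z - f y \<le> (z - y) * g y"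
    and f0: "f 0 = 0"
  shows "\<exists>W. has_W_law f W"
proof -
  define U where "U = uniform_measure lborel {0<..<1::real}"
  \<comment> \<open>The generalised inverse of the decreasing function \<open>g\<close>. If
    \<open>g\<close> never falls to \<open>u\<close>, the set is empty and
    \<open>w u = \<infinity>\<close>, which is how mass at infinity arises.\<close>
  define w where "w u = Inf {ereal y | y. g y \<le> u}" for u
  interpret U: prob_space U
    unfolding U_def by (rule prob_space_uniform_measure) auto
  have setsU[measurable_cong]: "sets U = sets borel" by (simp add: U_def)
  have spU: "space U = UNIV" by (simp add: U_def)
  have gmono: "g z \<le> g y" if "y \<le> z" for y z
  proof (cases "y = z")
    case False
    have "(z - y) * g z \<le> (z - y) * g y" using slope[OF that] by simp
    then show ?thesis using that False by simp
  qed simp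
  have wle: "w u \<le> ereal y" if "g y \<le> u" for u y
    unfolding w_def using that by (intro Inf_lower) auto
  have wge: "ereal z \<le> w u" if "u < g z" for u z
    unfolding w_def
  proof (rule Inf_greatest)
    fix x assume "x \<in> {ereal y | y. g y \<le> u}"
    then obtain y where y: "x = ereal y" "g y \<le> u" by auto
    then have "z \<le> y" using gmono[of y z] that by (meson le_cases less_le_trans not_le order.trans)
    then show "ereal z \<le> x" using y by simp
  qed
  have wmono: "w u' \<le> w u" if "u \<le> u'" for u u'
    unfolding w_def using that by (intro Inf_superset_mono) (auto intro: order_trans)
  have wm[measurable]: "w \<in> borel_measurable borel"
  proof (subst borel_measurable_iff_Iic_ereal, intro allI)
    fix a
    have "is_interval (w -` {..a})"
      unfolding is_interval_1 using wmono by (auto intro: order_trans)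
    then show "w -` {..a} \<inter> space borel \<in> sets borel" by (simp add: real_interval_borel_measurable)
  qed
  have AE01: "AE u::real in U. 0 < u \<and> u < 1"
    unfolding U_def by (rule AE_uniform_measureI) auto
  have U_Ioo: "measure U {0<..<x} = x" if "0 \<le> x" "x \<le> 1" for x
  proof -
    have "{0<..<1} \<inter> {0<..<x} = {0<..<x}" using that by auto
    then have "emeasure U {0<..<x} = ennreal x"
      using that unfolding U_def by (subst emeasure_uniform_measure) (auto simp: divide_ennreal_def)
    then show ?thesis using that by (simp add: measure_def)
  qed
  define W where "W = distr U borel w"
  define m where "m y u = real_of_ereal (min (ereal y) (w u))" for y u
  define F where "F y = (\<integral>u. m y u \<partial>U)" for y
  have mm[measurable]: "m y \<in> borel_measurable U" for y unfolding m_def by measurable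
  \<comment> \<open>Since \<open>g\<close> is 1 on the negative axis, levels below 1 are reached
    only at nonnegative points; this bounds \<open>m y\<close> and fixes
    \<open>F 0 = 0\<close>.\<close>
  have wnonneg: "0 \<le> w u" if "u < 1" for u :: real
  proof (rule ccontr)
    assume "\<not> 0 \<le> w u"
    then have "w u < 0" by simp
    then obtain x where "x \<in> {ereal y | y. g y \<le> u}" "x < 0"
      unfolding w_def by (auto simp: Inf_less_iff)
    then obtain y where "g y \<le> u" "y < 0" by (auto simp: zero_ereal_def)
    then show False using g1[of y] that by simp
  qed
  have mint: "integrable U (m y)" for y
  proof (rule U.integrable_const_bound[where B="\<bar>y\<bar>"])
    show "AE u::real in U. norm (m y u) \<le> \<bar>y\<bar>"
      using AE01
    proof eventually_elim
      fix u :: real assume "0 < u \<and> u < 1"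
      then have "0 \<le> w u" using wnonneg by simp
      then show "norm (m y u) \<le> \<bar>y\<bar>" unfolding m_def by (cases "w u") (auto simp: min_def)
    qed
  qed simp
  have Fup: "F z - F y \<le> (z - y) * g y" if "y \<le> z" for y z
  proof -
    have "F z - F y = (\<integral>u. m z u - m y u \<partial>U)" unfolding F_def using mint by simp
    also have "\<dots> \<le> (\<integral>u. (z - y) * indicator {0<..<g y} u \<partial>U)"
    proof (rule integral_mono_AE)
      show "AE u::real in U. m z u - m y u \<le> (z - y) * indicator {0<..<g y} u"
        using AE01
      proof eventually_elim
        fix u :: real assume u: "0 < u \<and> u < 1"
        show "m z u - m y u \<le> (z - y) * indicator {0<..<g y} u"
        proof -
          have "(z - y) * indicator {ereal y<..} (w u) \<le> (z - y) * indicator {0<..<g y} u"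
            using wle[of y u] u that
            by (intro mult_left_mono) (auto simp: indicator_def not_less[symmetric])
          then show ?thesis using real_min_diff_le[OF that, of "w u"] by (simp add: m_def)
        qed
      qed
    qed (auto intro!: mint integrable_mult_right Bochner_Integration.integrable_diff simp: less_top[symmetric])
    also have "\<dots> = (z - y) * g y" using U_Ioo[of "g y"] g01[of y] by simp
    finally show ?thesis .
  qed
  have Flo: "(z - y) * g z \<le> F z - F y" if "y \<le> z" for y z
  proof -
    have "(z - y) * g z = (\<integral>u. (z - y) * indicator {0<..<g z} u \<partial>U)"
      using U_Ioo[of "g z"] g01[of z] by simp
    also have "\<dots> \<le> (\<integral>u. m z u - m y u \<partial>U)"
    proof (rule integral_mono_AE)
      show "AE u::real in U. (z - y) * indicator {0<..<g z} u \<le> m z u - m y u"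
        using AE01
      proof eventually_elim
        fix u :: real assume u: "0 < u \<and> u < 1"
        show "(z - y) * indicator {0<..<g z} u \<le> m z u - m y u"
        proof -
          have "(z - y) * indicator {0<..<g z} u \<le> (z - y) * indicator {ereal z..} (w u)"
            using wge[of u z] u that
            by (intro mult_left_mono) (auto simp: indicator_def)
          then show ?thesis using real_min_diff_ge[OF that, of "w u"] by (simp add: m_def)
        qed
      qed
    qed (auto intro!: mint integrable_mult_right Bochner_Integration.integrable_diff simp: less_top[symmetric])
    also have "\<dots> = F z - F y" unfolding F_def using mint by simp
    finally show ?thesis .
  qed
  txt \<open>
    Over a partition of \<open>[y, z]\<close> into steps of length \<open>h\<close>, the variation of \<open>F - f\<close> is at most the
    telescoping sum \<open>h * (g y - g z)\<close>, hence 0.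
  \<close>
  define d where "d y = F y - f y" for y
  have dd: "\<bar>d z - d y\<bar> \<le> (z - y) * (g y - g z)" if "y \<le> z" for y z
    using Fup[OF that] Flo[OF that] slope[OF that] by (auto simp: d_def abs_le_iff algebra_simps)
  have dconst: "d z = d y" if "y \<le> z" for y z
  proof -
    have bnd: "\<bar>d z - d y\<bar> \<le> (z - y) / real (Suc n)" for n
    proof -
      define h where "h = (z - y) / real (Suc n)"
      define x where "x i = y + real i * h" for i
      have h0: "0 \<le> h" using that by (simp add: h_def)
      have xx: "x (Suc n) = z" "x 0 = y" by (simp_all add: x_def h_def)
      have "\<bar>d z - d y\<bar> = \<bar>\<Sum>i<Suc n. d (x (Suc i)) - d (x i)\<bar>"
        by (subst sum_lessThan_telescope) (simp add: xx)
      also have "\<dots> \<le> (\<Sum>i<Suc n. h * (g (x i) - g (x (Suc i))))"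
      proof (rule order_trans[OF sum_abs sum_mono])
        fix i
        have "x (Suc i) - x i = h" by (simp add: x_def algebra_simps)
        moreover from this have "x i \<le> x (Suc i)" using h0 by simp
        ultimately show "\<bar>d (x (Suc i)) - d (x i)\<bar> \<le> h * (g (x i) - g (x (Suc i)))"
          using dd[of "x i" "x (Suc i)"] by simp
      qed
      also have "\<dots> = h * (g y - g z)"
        unfolding sum_distrib_left[symmetric] by (subst sum_lessThan_telescope') (simp add: xx)
      also have "\<dots> \<le> h * 1" using g01[of y] g01[of z] h0 by (intro mult_left_mono) auto
      finally show ?thesis by (simp add: h_def)
    qed
    have "(\<lambda>n. (z - y) / real (Suc n)) \<longlonglongrightarrow> 0"
      using LIMSEQ_Suc[OF lim_const_over_n[of "z - y"]] by simp
    then have "\<bar>d z - d y\<bar> \<le> 0" by (rule LIMSEQ_le_const) (use bnd in blast)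
    then show ?thesis by simp
  qed
  have "F 0 = (\<integral>u. 0 \<partial>U)"
    unfolding F_def
  proof (rule integral_cong_AE)
    show "AE u::real in U. m 0 u = 0" using AE01
    proof eventually_elim
      fix u :: real assume "0 < u \<and> u < 1"
      then have "0 \<le> w u" using wnonneg by simp
      then show "m 0 u = 0" unfolding m_def by (cases "w u") (auto simp: min_def)
    qed
  qed auto
  then have "d 0 = 0" using f0 by (simp add: d_def)
  then have Ff: "F y = f y" for y
    using dconst[of 0 y] dconst[of y 0] by (cases "0 \<le> y") (auto simp: d_def)
  have "has_W_law f W"
    unfolding has_W_law_def
  proof (intro conjI allI)
    show "prob_space W" unfolding W_def by (rule U.prob_space_distr) simp
    show "sets W = sets borel" by (simp add: W_def)
    show "has_bochner_integral W (\<lambda>w. real_of_ereal (min (ereal y) w)) (f y)" for y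
      using mint[of y] Ff[of y] unfolding W_def F_def m_def
      by (subst has_bochner_integral_distr) (auto simp: has_bochner_integral_iff)
  qed
  then show ?thesis by blast
qed

text \<open>The right derivative of a concave function is the tail function of the law.\<close>

lemma concave_has_W_law:
  fixes f :: "real \<Rightarrow> real"
  assumes conc: "concave_on UNIV f"
    and mono: "\<And>y z. y \<le> z \<Longrightarrow> f y \<le> f z" and lip: "\<And>y z. y \<le> z \<Longrightarrow> f z - f y \<le> z - y"
    and neg: "\<And>y. y \<le> 0 \<Longrightarrow> f y = y"
  shows "\<exists>!W. has_W_law f W"
proof -
  \<comment> \<open>By concavity the chord slopes decrease in \<open>z\<close>, so the supremum is
    the right derivative at \<open>y\<close>.\<close>
  define g where "g y = (SUP z\<in>{y<..}. (f z - f y) / (z - y))" for y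
  have ne: "{y<..} \<noteq> {}" for y :: real using lt_ex gt_ex by auto
  have le1: "(f z - f y) / (z - y) \<le> 1" if "y < z" for y z
    using lip[of y z] that by (simp add: field_simps)
  have bdd: "bdd_above ((\<lambda>z. (f z - f y) / (z - y)) ` {y<..})" for y
    unfolding bdd_above_def using le1 by blast
  have upper: "(f z - f y) / (z - y) \<le> g y" if "y < z" for y z
    unfolding g_def using that bdd by (intro cSUP_upper) auto
  \<comment> \<open>Chords to the right of \<open>z\<close> are no steeper than the chord over
    \<open>[y, z]\<close>, because \<open>z\<close> is a convex combination of \<open>y\<close> and
    \<open>v\<close>; \<open>t\<close> is its coefficient.\<close>
  have lower: "g z \<le> (f z - f y) / (z - y)" if "y < z" for y z
    unfolding g_def
  proof (rule cSUP_least[OF ne])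
    fix v assume "v \<in> {z<..}"
    then have zv: "z < v" by simp
    define t where "t = (z - y) / (v - y)"
    have t: "0 \<le> t" "t \<le> 1" using that zv by (auto simp: t_def field_simps)
    have z: "z = (1 - t) * y + t * v"
    proof -
      have "t * (v - y) = z - y" using that zv by (simp add: t_def)
      then show ?thesis by (simp add: algebra_simps)
    qed
    have "(1 - t) * f y + t * f v \<le> f z"
      using conc t unfolding z concave_on_iff by auto
    then have "t * (f v - f y) \<le> f z - f y" by (simp add: algebra_simps)
    then have "(z - y) * (f v - f y) \<le> (f z - f y) * (v - y)"
      using that zv by (simp add: t_def field_simps)
    then have "(f v - f z) * (z - y) \<le> (f z - f y) * (v - z)" by (simp add: algebra_simps)
    then show "(f v - f z) / (v - z) \<le> (f z - f y) / (z - y)"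
      using that zv by (simp add: field_simps)
  qed
  have "\<exists>W. has_W_law f W"
  proof (rule quantile_function_law[where g=g])
    show "0 \<le> g y" for y
      using upper[of y "y + 1"] mono[of y "y + 1"] by simp
    show gle: "g y \<le> 1" for y
      unfolding g_def using le1 by (intro cSUP_least[OF ne]) auto
    show "g y = 1" if "y < 0" for y
      using upper[of y 0] gle[of y] neg[of y] neg[of 0] that by simp
    show "(z - y) * g z \<le> f z - f y" if "y \<le> z" for y z
      using lower[of y z] that by (cases "y = z") (auto simp: field_simps)
    show "f z - f y \<le> (z - y) * g y" if "y \<le> z" for y z
      using upper[of y z] that by (cases "y = z") (auto simp: field_simps)
    show "f 0 = 0" using neg by simp
  qed
  then show ?thesis using has_W_law_unique by blast
qed

section \<open>Local values\<close>

text \<open>Sub-probabilities are allowed because conditioning on a null history produces the zero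
  measure.\<close>

locale cost_mdp =
  fixes N :: "('s, 'a) mdp"
  assumes subprob_trans: "subprob_space (trans N s a)"
    and cost_nonneg: "0 \<le> action_cost N s a"
    and val_nonneg: "0 \<le> val N s"
begin

text \<open>The bounds must straddle 0 because the transition may have total mass below 1.\<close>

lemma integral_trans_bounds:
  fixes f :: "'s \<Rightarrow> real"
  assumes "integrable (trans N s a) f" "\<And>s'. l \<le> f s'" "\<And>s'. f s' \<le> u" "l \<le> 0" "0 \<le> u"
  shows "l \<le> (\<integral>s'. f s' \<partial>trans N s a)" "(\<integral>s'. f s' \<partial>trans N s a) \<le> u"
proof -
  interpret subprob_space "trans N s a" by (rule subprob_trans)
  let ?m = "measure (trans N s a) (space (trans N s a))"
  have m: "0 \<le> ?m" "?m \<le> 1" by (simp_all add: subprob_measure_le_1)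
  have "l * 1 \<le> l * ?m" using m assms(4) by (intro mult_left_mono_neg) auto
  also have "\<dots> = (\<integral>s'. l \<partial>trans N s a)" by simp
  also have "\<dots> \<le> (\<integral>s'. f s' \<partial>trans N s a)" using assms by (intro integral_mono) auto
  finally show "l \<le> (\<integral>s'. f s' \<partial>trans N s a)" by simp
  have "(\<integral>s'. f s' \<partial>trans N s a) \<le> (\<integral>s'. u \<partial>trans N s a)"
    using assms by (intro integral_mono) auto
  also have "\<dots> = u * ?m" by simp
  also have "\<dots> \<le> u * 1" using m assms(5) by (intro mult_left_mono) auto
  finally show "(\<integral>s'. f s' \<partial>trans N s a) \<le> u" by simp
qed

text \<open>A policy tree does not depend on \<open>y\<close>, so \<open>y\<close> enters its cost
  only through the probability \<open>b\<close> of ending at the outside option.\<close>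

lemma total_cost_affine:
  assumes "admissible N p s"
  shows "\<exists>a b. 0 \<le> a \<and> 0 \<le> b \<and> b \<le> 1 \<and> (\<forall>y. total_cost N y p s = a + b * y)"
  using assms
proof (induction p arbitrary: s)
  case Take_Outside
  show ?case by (intro exI[of _ 0] exI[of _ 1]) simp
next
  case Accept
  show ?case by (intro exI[of _ "val N s"] exI[of _ 0]) (simp add: val_nonneg)
next
  case (Advance x k)
  have "\<exists>a b. 0 \<le> a \<and> 0 \<le> b \<and> b \<le> 1 \<and> (\<forall>y. total_cost N y (k s') s' = a + b * y)" for s'
    using Advance by auto
  then obtain a b where ab: "\<And>s'. 0 \<le> a s'" "\<And>s'. 0 \<le> b s'" "\<And>s'. b s' \<le> 1"
      "\<And>s' y. total_cost N y (k s') s' = a s' + b s' * y"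
    by metis
  have int: "integrable (trans N s x) (\<lambda>s'. a s' + b s' * y)" for y
    using Advance.prems by (simp add: ab(4))
  \<comment> \<open>Integrability is known for the combination at every \<open>y\<close>:
    \<open>y = 0\<close> isolates \<open>a\<close>, and the difference between \<open>y = 1\<close>
    and \<open>y = 0\<close> isolates \<open>b\<close>.\<close>
  from int[of 0] have ia: "integrable (trans N s x) a" by simp
  from Bochner_Integration.integrable_diff[OF int[of 1] int[of 0]]
  have ib: "integrable (trans N s x) b" by simp
  have "0 \<le> (\<integral>s'. b s' \<partial>trans N s x)" "(\<integral>s'. b s' \<partial>trans N s x) \<le> 1"
    by (rule integral_trans_bounds[OF ib, of 0 1]; simp add: ab)+
  moreover have "0 \<le> action_cost N s x + (\<integral>s'. a s' \<partial>trans N s x)"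
    using cost_nonneg ab(1) by simp
  ultimately show ?case
    using ia ib
    by (intro exI[of _ "action_cost N s x + (\<integral>s'. a s' \<partial>trans N s x)"]
          exI[of _ "\<integral>s'. b s' \<partial>trans N s x"]) (simp add: ab(4))
qed

text \<open>A lower bound independent of the policy, which makes the infimum in
  \<open>local_value\<close> a genuine one.\<close>

lemma total_cost_ge:
  assumes "admissible N p s"
  shows "min 0 y \<le> total_cost N y p s"
proof -
  obtain a b where ab: "0 \<le> a" "0 \<le> b" "b \<le> 1" "total_cost N y p s = a + b * y"
    using total_cost_affine[OF assms] by metis
  have "min 0 y \<le> b * y"
  proof (cases "0 \<le> y")
    case False
    then have "1 * y \<le> b * y" using ab by (intro mult_right_mono_neg) auto
    then show ?thesis using False by simp
  qed (use ab in auto)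
  then show ?thesis using ab by simp
qed

lemma local_value_le:
  assumes "admissible N p (initial N)"
  shows "local_value N y \<le> total_cost N y p (initial N)"
  unfolding local_value_def
  using assms total_cost_ge by (intro cINF_lower bdd_belowI[of _ "min 0 y"]) auto

lemma local_value_le_outside: "local_value N y \<le> y"
  using local_value_le[of Take_Outside y] by simp

lemma local_value_greatest:
  assumes "\<And>p. admissible N p (initial N) \<Longrightarrow> l \<le> total_cost N y p (initial N)"
  shows "l \<le> local_value N y"
  unfolding local_value_def
proof (rule cINF_greatest)
  have "Take_Outside \<in> {p. admissible N p (initial N)}" by simp
  then show "{p. admissible N p (initial N)} \<noteq> {}" by blast
qed (use assms in auto)

text \<open>An infimum of affine functions of \<open>y\<close> with slopes in \<open>[0, 1]\<close>
  is concave, increasing and 1-Lipschitz, and nonnegative costs give the value \<open>y\<close> for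
  \<open>y <= 0\<close>. Hence the \<open>THE\<close> in \<open>W_law\<close> denotes a unique
  law.\<close>

lemma local_value_W_law: "has_W_law (local_value N) (W_law N)"
proof -
  let ?s = "initial N"
  have "\<exists>!W. has_W_law (local_value N) W"
  proof (rule concave_has_W_law)
    show "concave_on UNIV (local_value N)"
      unfolding concave_on_iff
    proof (intro conjI ballI allI impI)
      fix x y u v :: real assume uv: "0 \<le> u" "0 \<le> v" "u + v = 1"
      show "u * local_value N x + v * local_value N y \<le> local_value N (u *\<^sub>R x + v *\<^sub>R y)"
      proof (rule local_value_greatest)
        fix p assume p: "admissible N p ?s"
        then obtain a b where ab: "\<And>y. total_cost N y p ?s = a + b * y"
          using total_cost_affine by metis
        have "u * local_value N x + v * local_value N y
            \<le> u * total_cost N x p ?s + v * total_cost N y p ?s"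
          using local_value_le[OF p] uv by (intro add_mono mult_left_mono) auto
        also have "\<dots> = (u + v) * a + b * (u * x + v * y)" unfolding ab by (simp add: algebra_simps)
        also have "\<dots> = total_cost N (u *\<^sub>R x + v *\<^sub>R y) p ?s" unfolding ab uv by simp
        finally show "u * local_value N x + v * local_value N y
            \<le> total_cost N (u *\<^sub>R x + v *\<^sub>R y) p ?s" .
      qed
    qed simp
  next
    fix y z :: real assume yz: "y \<le> z"
    show "local_value N y \<le> local_value N z"
    proof (rule local_value_greatest)
      fix p assume p: "admissible N p ?s"
      then obtain a b where ab: "0 \<le> b" "\<And>y. total_cost N y p ?s = a + b * y"
        using total_cost_affine by metis
      then show "local_value N y \<le> total_cost N z p ?s"
        using local_value_le[OF p, of y] mult_left_mono[OF yz, of b] by simp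
    qed
    have "local_value N z - (z - y) \<le> local_value N y"
    proof (rule local_value_greatest)
      fix p assume p: "admissible N p ?s"
      then obtain a b where ab: "b \<le> 1" "\<And>y. total_cost N y p ?s = a + b * y"
        using total_cost_affine by metis
      have "b * (z - y) \<le> 1 * (z - y)" using ab yz by (intro mult_right_mono) auto
      then show "local_value N z - (z - y) \<le> total_cost N y p ?s"
        using local_value_le[OF p, of z] ab by (simp add: algebra_simps)
    qed
    then show "local_value N z - local_value N y \<le> z - y" by simp
  next
    fix y :: real assume "y \<le> 0"
    then show "local_value N y = y"
      using total_cost_ge[of _ ?s y] local_value_le_outside[of y] local_value_greatest[of y y]
      by (fastforce simp: min_def)
  qed
  then show ?thesis
    unfolding W_law_def is_W_law_iff by (rule theI')
qed

end

text \<open>The slope of \<open>h\<close> gives \<open>Pr[W >= t] <= b\<close>, so with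
  \<open>q = Pr[W <= t] >= 1 - b\<close> the \<open>q\<close>-quantile of \<open>W\<close> is at
  most \<open>t\<close>. That of \<open>V\<close> is then below \<open>y\<close>, whence
  \<open>Pr[V > y] <= 1 - q <= b\<close>, and this tail bounds the slope of
  \<open>f\<close>.\<close>

lemma quantile_transfer:
  assumes V: "has_W_law f V" and W: "has_W_law h W"
    and approx: "\<forall>q\<in>{0..1}. quantile V q \<le> ereal \<alpha> * quantile W q" and "0 \<le> \<alpha>"
    and slope: "h t - h t' \<le> (t - t') * b" "t' < t"
    and y: "\<alpha> * t < y" "y \<le> z"
  shows "f z - f y \<le> (z - y) * b"
proof -
  interpret V: prob_space V using V by (simp add: has_W_law_def)
  interpret W: prob_space W using W by (simp add: has_W_law_def)
  have sets: "sets V = sets borel" "sets W = sets borel" using V W by (simp_all add: has_W_law_def)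
  then have space: "space V = UNIV" "space W = UNIV" by (auto dest: sets_eq_imp_space_eq)
  have compl: "V.prob {ereal r<..} = 1 - V.prob {..ereal r}" "W.prob {ereal r<..} = 1 - W.prob {..ereal r}" for r
  proof -
    have eq: "{ereal r<..} = UNIV - {..ereal r}" by auto
    show "V.prob {ereal r<..} = 1 - V.prob {..ereal r}" "W.prob {ereal r<..} = 1 - W.prob {..ereal r}"
      unfolding eq using V.prob_compl[of "{..ereal r}"] W.prob_compl[of "{..ereal r}"]
      by (simp_all add: sets space)
  qed
  define q where "q = W.prob {..ereal t}"
  have "(t - t') * W.prob {ereal t..} \<le> (t - t') * b"
    using has_W_law_diff_ge[OF W, of t' t] slope by linarith
  then have "W.prob {ereal t..} \<le> b" using slope(2) by (subst (asm) mult_le_cancel_left_pos) auto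
  moreover have "W.prob {ereal t<..} \<le> W.prob {ereal t..}"
    by (rule W.finite_measure_mono) (auto simp: sets)
  ultimately have b: "1 - q \<le> b" using compl(2)[of t] by (simp add: q_def)
  have q01: "q \<in> {0..1}" by (simp add: q_def)
  have "quantile W q \<le> ereal t"
    unfolding quantile_def q_def by (rule Inf_lower) simp
  then have "ereal \<alpha> * quantile W q \<le> ereal \<alpha> * ereal t"
    using \<open>0 \<le> \<alpha>\<close> by (intro ereal_mult_left_mono) auto
  with approx q01 have "quantile V q \<le> ereal (\<alpha> * t)" by (fastforce intro: order_trans)
  \<comment> \<open>Strictness yields a member of the defining set of the quantile below
    \<open>y\<close>, without an appeal to right-continuity.\<close>
  also have "\<dots> < ereal y" using y by simp
  finally obtain x where x: "q \<le> V.prob {..x}" "x < ereal y"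
    unfolding quantile_def by (auto simp: Inf_less_iff)
  have "V.prob {..x} \<le> V.prob {..ereal y}"
    using x by (intro V.finite_measure_mono) (auto simp: sets intro: order_trans less_imp_le)
  with x b compl(1)[of y] have "V.prob {ereal y<..} \<le> b" by simp
  then have "(z - y) * V.prob {ereal y<..} \<le> (z - y) * b" using y by (intro mult_left_mono) auto
  then show ?thesis using has_W_law_diff_le[OF V y(2)] by simp
qed

section \<open>Markov chains\<close>

text \<open>\<open>S\<close> supplies the measurability that admissible policies require, and
  \<open>C\<close> bounds the cost of a single step.\<close>

locale bounded_chain = cost_mdp N for N :: "('s, unit) mdp" +
  fixes S :: "'s measure" and C :: real
  assumes space_S: "space S = UNIV"
    and kernel[measurable]: "(\<lambda>s. trans N s ()) \<in> S \<rightarrow>\<^sub>M subprob_algebra S"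
    and terminal_sets[measurable]: "terminal N \<in> sets S"
    and val_measurable[measurable]: "val N \<in> borel_measurable S"
    and cost_measurable[measurable]: "(\<lambda>s. action_cost N s ()) \<in> borel_measurable S"
    and cost_le: "action_cost N s () \<le> C"
begin

lemma sets_trans[measurable_cong]: "sets (trans N s ()) = sets S"
  using subprob_measurableD(2)[OF kernel, of s] by (simp add: space_S)

lemma integrable_trans:
  fixes f :: "'s \<Rightarrow> real"
  assumes [measurable]: "f \<in> borel_measurable S" and "\<And>s. \<bar>f s\<bar> \<le> b"
  shows "integrable (trans N s ()) f"
proof -
  interpret subprob_space "trans N s ()" by (rule subprob_trans)
  show ?thesis using assms by (intro integrable_const_bound[of _ b]) auto
qed

text \<open>The Bellman recursion with at most \<open>m\<close> transitions left. Admissible trees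
  may have unbounded depth, so the local value is recovered in the limit.\<close>

primrec horizon_value :: "real \<Rightarrow> nat \<Rightarrow> 's \<Rightarrow> real" where
  "horizon_value y 0 s = (if s \<in> terminal N then min y (val N s) else y)"
| "horizon_value y (Suc m) s =
     (if s \<in> terminal N then min y (val N s)
      else min y (action_cost N s () + (\<integral>s'. horizon_value y m s' \<partial>trans N s ())))"

lemma horizon_value_measurable[measurable]: "horizon_value y m \<in> borel_measurable S"
proof (induction m)
  case (Suc m)
  note Suc[measurable]
  have [measurable]: "(\<lambda>s. \<integral>s'. horizon_value y m s' \<partial>trans N s ()) \<in> borel_measurable S"
    by (rule measurable_compose[OF kernel integral_measurable_subprob_algebra]) simp
  show ?case unfolding horizon_value.simps by measurable
next
  case 0
  show ?case unfolding horizon_value.simps by measurable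
qed

lemma horizon_value_le: "horizon_value y m s \<le> y"
  by (cases m) auto

context
  fixes y :: real
  assumes y: "0 \<le> y"
begin

lemma horizon_value_nonneg: "0 \<le> horizon_value y m s"
  using y val_nonneg cost_nonneg
  by (induction m arbitrary: s) (auto intro!: add_nonneg_nonneg)

lemma horizon_value_abs: "\<bar>horizon_value y m s\<bar> \<le> y"
  using horizon_value_nonneg horizon_value_le by auto

lemma integrable_horizon_value: "integrable (trans N s ()) (horizon_value y m)"
  using horizon_value_abs by (intro integrable_trans) auto

lemma horizon_value_Suc_le: "horizon_value y (Suc m) s \<le> horizon_value y m s"
proof (induction m arbitrary: s)
  case (Suc m)
  have "(\<integral>s'. horizon_value y (Suc m) s' \<partial>trans N s ())
      \<le> (\<integral>s'. horizon_value y m s' \<partial>trans N s ())"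
    by (intro integral_mono integrable_horizon_value Suc)
  then show ?case
    unfolding horizon_value.simps(2)[of y "Suc m" s] horizon_value.simps(2)[of y m s]
    by (auto simp: min_def simp del: horizon_value.simps)
qed auto

definition limit_value :: "'s \<Rightarrow> real" where
  "limit_value s = (INF m. horizon_value y m s)"

lemma horizon_value_tendsto: "(\<lambda>m. horizon_value y m s) \<longlonglongrightarrow> limit_value s"
  unfolding limit_value_def
proof (rule LIMSEQ_decseq_INF)
  show "bdd_below (range (\<lambda>m. horizon_value y m s))"
    using horizon_value_nonneg by (auto intro: bdd_belowI[of _ 0])
  show "decseq (\<lambda>m. horizon_value y m s)"
    by (intro decseq_SucI horizon_value_Suc_le)
qed

lemma limit_value_le: "limit_value s \<le> horizon_value y m s"
  unfolding limit_value_def using horizon_value_nonneg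
  by (intro cINF_lower bdd_belowI[of _ 0]) auto

lemma limit_value_measurable[measurable]: "limit_value \<in> borel_measurable S"
  by (rule borel_measurable_LIMSEQ_metric[OF _ horizon_value_tendsto]) simp

lemma limit_value_abs: "\<bar>limit_value s\<bar> \<le> y"
proof -
  have "0 \<le> limit_value s"
    unfolding limit_value_def using horizon_value_nonneg by (intro cINF_greatest) auto
  then show ?thesis using limit_value_le[of s 0] horizon_value_le[of y 0 s] by simp
qed

text \<open>The Bellman inequality at horizon \<open>Suc m\<close> passes to the limit by dominated
  convergence with the constant bound \<open>y\<close>.\<close>

lemma limit_value_step:
  assumes "s \<notin> terminal N"
  shows "limit_value s \<le> action_cost N s () + (\<integral>s'. limit_value s' \<partial>trans N s ())"
proof (rule LIMSEQ_le_const)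
  have "(\<lambda>m. \<integral>s'. horizon_value y m s' \<partial>trans N s ())
      \<longlonglongrightarrow> (\<integral>s'. limit_value s' \<partial>trans N s ())"
  proof (rule integral_dominated_convergence[where w="\<lambda>_. y"])
    show "integrable (trans N s ()) (\<lambda>_. y)" by (rule integrable_trans[of _ "\<bar>y\<bar>"]) auto
  qed (use horizon_value_tendsto horizon_value_abs in auto)
  then show "(\<lambda>m. action_cost N s () + (\<integral>s'. horizon_value y m s' \<partial>trans N s ()))
      \<longlonglongrightarrow> action_cost N s () + (\<integral>s'. limit_value s' \<partial>trans N s ())"
    by (intro tendsto_intros)
  show "\<exists>n0. \<forall>m\<ge>n0. limit_value s \<le> action_cost N s () + (\<integral>s'. horizon_value y m s' \<partial>trans N s ())"
    using limit_value_le[of s "Suc m" for m] assms by (intro exI[of _ 0]) (simp add: min_le_iff_disj)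
qed

text \<open>Induction on the tree, using the limiting Bellman inequality at each
  \<open>Advance\<close>, handles policies of unbounded depth.\<close>

lemma limit_value_le_total_cost:
  assumes "admissible N p s"
  shows "limit_value s \<le> total_cost N y p s"
  using assms
proof (induction p arbitrary: s)
  case Take_Outside
  show ?case using limit_value_abs[of s] by simp
next
  case Accept
  then show ?case using limit_value_le[of s 0] by simp
next
  case (Advance a k)
  have "(\<integral>s'. limit_value s' \<partial>trans N s ()) \<le> (\<integral>s'. total_cost N y (k s') s' \<partial>trans N s ())"
    using Advance limit_value_abs
    by (intro integral_mono integrable_trans[OF limit_value_measurable]) auto
  then show ?case using limit_value_step[of s] Advance.prems by simp
qed

primrec horizon_policy :: "nat \<Rightarrow> 's \<Rightarrow> ('s, unit) policy" where
  "horizon_policy 0 s = (if s \<in> terminal N \<and> val N s \<le> y then Accept else Take_Outside)"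
| "horizon_policy (Suc m) s =
     (if s \<in> terminal N then if val N s \<le> y then Accept else Take_Outside
      else if action_cost N s () + (\<integral>s'. horizon_value y m s' \<partial>trans N s ()) \<le> y
      then Advance () (horizon_policy m) else Take_Outside)"

lemma total_cost_horizon_policy: "total_cost N y (horizon_policy m s) s = horizon_value y m s"
  by (induction m arbitrary: s) auto

text \<open>\<open>admissible\<close> asks for integrability at every outside cost \<open>x\<close>,
  while the decisions are tuned to \<open>y\<close>; hence the two parameters. Accepted values are
  at most \<open>y\<close>, and each of at most \<open>m\<close> steps costs at most
  \<open>C\<close>.\<close>

lemma total_cost_horizon_policy_bounded:
  "(\<lambda>s. total_cost N x (horizon_policy m s) s) \<in> borel_measurable S \<and>
   (\<forall>s. \<bar>total_cost N x (horizon_policy m s) s\<bar> \<le> \<bar>x\<bar> + y + real m * C)"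
proof (induction m)
  case 0
  have "(\<lambda>s. if s \<in> terminal N \<and> val N s \<le> y then val N s else x) \<in> borel_measurable S"
    by measurable
  moreover have "(\<lambda>s. total_cost N x (horizon_policy 0 s) s)
      = (\<lambda>s. if s \<in> terminal N \<and> val N s \<le> y then val N s else x)"
    by auto
  ultimately show ?case using val_nonneg y by auto
next
  case (Suc m)
  define T where "T s = total_cost N x (horizon_policy m s) s" for s
  define B where "B = \<bar>x\<bar> + y + real m * C"
  have Tm[measurable]: "T \<in> borel_measurable S" and Tb: "\<And>s. \<bar>T s\<bar> \<le> B"
    using Suc by (simp_all add: T_def[abs_def] B_def)
  have [measurable]: "(\<lambda>s. \<integral>s'. T s' \<partial>trans N s ()) \<in> borel_measurable S"
    "(\<lambda>s. \<integral>s'. horizon_value y m s' \<partial>trans N s ()) \<in> borel_measurable S"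
    by (rule measurable_compose[OF kernel integral_measurable_subprob_algebra]; simp)+
  have eq: "(\<lambda>s. total_cost N x (horizon_policy (Suc m) s) s) =
    (\<lambda>s. if s \<in> terminal N then if val N s \<le> y then val N s else x
      else if action_cost N s () + (\<integral>s'. horizon_value y m s' \<partial>trans N s ()) \<le> y
      then action_cost N s () + (\<integral>s'. T s' \<partial>trans N s ()) else x)"
    by (auto simp: T_def)
  have C0: "0 \<le> C" using cost_nonneg cost_le order_trans by blast
  then have B0: "0 \<le> B" using y by (simp add: B_def)
  have Ti: "\<bar>\<integral>s'. T s' \<partial>trans N s ()\<bar> \<le> B" for s
    using integral_trans_bounds[OF integrable_trans[OF Tm Tb], of "- B" B s] Tb B0
    by (auto simp: abs_le_iff minus_le_iff)
  have B: "\<bar>x\<bar> + y + real (Suc m) * C = B + C" "\<bar>x\<bar> \<le> B" "y \<le> B"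
    using y C0 by (simp_all add: B_def algebra_simps)
  have "(\<lambda>s. total_cost N x (horizon_policy (Suc m) s) s) \<in> borel_measurable S"
    unfolding eq by measurable
  moreover have "\<bar>total_cost N x (horizon_policy (Suc m) s) s\<bar> \<le> B + C" for s
    unfolding fun_cong[OF eq, of s]
    using B C0 Ti[of s] val_nonneg[of s] cost_nonneg[of s "()"] cost_le[of s] by auto
  ultimately show ?case unfolding B by blast
qed

lemma admissible_horizon_policy: "admissible N (horizon_policy m s) s"
proof (induction m arbitrary: s)
  case (Suc m)
  have "integrable (trans N s ()) (\<lambda>s'. total_cost N x (horizon_policy m s') s')" for x
    using total_cost_horizon_policy_bounded[of x m] by (intro integrable_trans) auto
  then show ?case using Suc by auto
qed auto

text \<open>Finite-horizon policies are admissible and attain the horizon values, and the limit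
  value bounds every admissible policy from below.\<close>

lemma horizon_value_tendsto_local_value:
  "(\<lambda>m. horizon_value y m (initial N)) \<longlonglongrightarrow> local_value N y"
proof -
  have "local_value N y \<le> horizon_value y m (initial N)" for m
    using local_value_le[OF admissible_horizon_policy, of y m] by (simp add: total_cost_horizon_policy)
  then have "local_value N y \<le> limit_value (initial N)"
    unfolding limit_value_def by (intro cINF_greatest) auto
  moreover have "limit_value (initial N) \<le> local_value N y"
    by (rule local_value_greatest) (rule limit_value_le_total_cost)
  ultimately show ?thesis using horizon_value_tendsto by simp
qed

end

text \<open>Truncation at the outside cost is monotone and 1-Lipschitz, and a transition of mass at
  most 1 preserves both properties.\<close>

lemma horizon_value_diff:
  assumes "0 \<le> y" "y \<le> z"
  shows "0 \<le> horizon_value z m s - horizon_value y m s \<and>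
    horizon_value z m s - horizon_value y m s \<le> z - y"
proof (induction m arbitrary: s)
  case (Suc m)
  have int: "integrable (trans N s ()) (horizon_value z m)" "integrable (trans N s ()) (horizon_value y m)"
    using assms by (auto intro: integrable_horizon_value)
  have "0 \<le> (\<integral>s'. horizon_value z m s' - horizon_value y m s' \<partial>trans N s ())"
    "(\<integral>s'. horizon_value z m s' - horizon_value y m s' \<partial>trans N s ()) \<le> z - y"
    by (rule integral_trans_bounds[OF Bochner_Integration.integrable_diff[OF int], of 0 "z - y"];
        use Suc assms in simp)+
  then show ?case using assms int by (auto simp: min_def)
qed (use assms in auto)

text \<open>
  The difference quotient of a horizon value is 1 where the outside option is taken and the expected
  next difference quotient where the chain goes on. As it never exceeds 1, it is at least that
  expectation in both cases, so the domination of \<open>\<beta>\<close> propagates backwards from the terminal states.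
\<close>

lemma submartingale_le_slopes:
  fixes w y z :: "'i \<Rightarrow> real" and \<beta> :: "'s \<Rightarrow> real"
  assumes I: "finite I" "\<And>i. i \<in> I \<Longrightarrow> 0 \<le> w i" "\<And>i. i \<in> I \<Longrightarrow> 0 \<le> y i" "\<And>i. i \<in> I \<Longrightarrow> y i < z i"
    and total: "1 \<le> (\<Sum>i\<in>I. w i)"
    and meas[measurable]: "\<beta> \<in> borel_measurable S" and \<beta>: "\<And>s. 0 \<le> \<beta> s" "\<And>s. \<beta> s \<le> 1"
    and sub: "\<And>s. s \<notin> terminal N \<Longrightarrow> \<beta> s \<le> (\<integral>s'. \<beta> s' \<partial>trans N s ())"
    and terminal: "\<And>s. s \<in> terminal N \<Longrightarrow>
      \<beta> s \<le> (\<Sum>i\<in>I. w i * ((min (z i) (val N s) - min (y i) (val N s)) / (z i - y i)))"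
  shows "\<beta> s \<le> (\<Sum>i\<in>I. w i * ((horizon_value (z i) m s - horizon_value (y i) m s) / (z i - y i)))"
proof (induction m arbitrary: s)
  case 0
  show ?case
  proof (cases "s \<in> terminal N")
    case False
    \<comment> \<open>With no transition left, a nonterminal state takes the outside option, so
      every difference quotient is 1.\<close>
    have "(\<Sum>i\<in>I. w i * ((z i - y i) / (z i - y i))) = (\<Sum>i\<in>I. w i)"
      using I by (intro sum.cong) (force simp: field_simps)+
    then show ?thesis using False total \<beta>(2)[of s] by simp
  qed (use terminal in simp)
next
  case (Suc m)
  define d where "d i s = (horizon_value (z i) m s - horizon_value (y i) m s) / (z i - y i)" for i s
  show ?case
  proof (cases "s \<in> terminal N")
    case False
    have int: "integrable (trans N s ()) (horizon_value (z i) m)"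
      "integrable (trans N s ()) (horizon_value (y i) m)" if "i \<in> I" for i
      using I(3)[OF that] I(4)[OF that] by (auto intro!: integrable_horizon_value)
    then have dint: "integrable (trans N s ()) (d i)" if "i \<in> I" for i
      unfolding d_def using that by auto
    have step: "(\<integral>s'. d i s' \<partial>trans N s ())
        \<le> (horizon_value (z i) (Suc m) s - horizon_value (y i) (Suc m) s) / (z i - y i)" if "i \<in> I" for i
    proof -
      let ?J = "\<lambda>x. \<integral>s'. horizon_value x m s' \<partial>trans N s ()"
      have yz: "0 \<le> y i" "y i < z i" using I that by auto
      have "(\<integral>s'. horizon_value (z i) m s' - horizon_value (y i) m s' \<partial>trans N s ()) \<le> z i - y i"
        by (rule integral_trans_bounds[OF Bochner_Integration.integrable_diff[OF int[OF that]], of 0 "z i - y i"])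
           (use horizon_value_diff[of "y i" "z i"] yz in auto)
      \<comment> \<open>As the continuation costs differ by at most \<open>z i - y i\<close>, taking
        minima with \<open>z i\<close> and \<open>y i\<close> cannot lower their difference.\<close>
      then have le: "?J (z i) - ?J (y i) \<le> z i - y i" using int[OF that] by simp
      have "(\<integral>s'. d i s' \<partial>trans N s ()) = (?J (z i) - ?J (y i)) / (z i - y i)"
        unfolding d_def using int[OF that] by simp
      also have "\<dots> \<le> (horizon_value (z i) (Suc m) s - horizon_value (y i) (Suc m) s) / (z i - y i)"
        using le yz False by (intro divide_right_mono) (auto simp: min_def)
      finally show ?thesis .
    qed
    have "\<beta> s \<le> (\<integral>s'. \<beta> s' \<partial>trans N s ())" by (rule sub[OF False])
    also have "\<dots> \<le> (\<integral>s'. (\<Sum>i\<in>I. w i * d i s') \<partial>trans N s ())"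
    proof (rule integral_mono)
      show "integrable (trans N s ()) \<beta>" using \<beta> by (intro integrable_trans[of \<beta> 1]) auto
      show "integrable (trans N s ()) (\<lambda>s'. \<Sum>i\<in>I. w i * d i s')"
        using dint by (intro Bochner_Integration.integrable_sum integrable_mult_right)
    qed (use Suc in \<open>simp add: d_def\<close>)
    also have "\<dots> = (\<Sum>i\<in>I. w i * (\<integral>s'. d i s' \<partial>trans N s ()))"
      using dint by simp
    also have "\<dots> \<le> (\<Sum>i\<in>I. w i * ((horizon_value (z i) (Suc m) s - horizon_value (y i) (Suc m) s) / (z i - y i)))"
      using step I by (intro sum_mono mult_left_mono) auto
    finally show ?thesis .
  qed (use terminal in simp)
qed

text \<open>The horizon tends to infinity in the previous bound. Applied to the conditional
  probability of an event, it says that the event's initial probability is paid for by slopes of the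
  local value.\<close>

lemma submartingale_le_local_value_slopes:
  fixes w y z :: "'i \<Rightarrow> real" and \<beta> :: "'s \<Rightarrow> real"
  assumes I: "finite I" "\<And>i. i \<in> I \<Longrightarrow> 0 \<le> w i" "\<And>i. i \<in> I \<Longrightarrow> 0 \<le> y i" "\<And>i. i \<in> I \<Longrightarrow> y i < z i"
    and total: "1 \<le> (\<Sum>i\<in>I. w i)"
    and meas[measurable]: "\<beta> \<in> borel_measurable S" and \<beta>: "\<And>s. 0 \<le> \<beta> s" "\<And>s. \<beta> s \<le> 1"
    and sub: "\<And>s. s \<notin> terminal N \<Longrightarrow> \<beta> s \<le> (\<integral>s'. \<beta> s' \<partial>trans N s ())"
    and terminal: "\<And>s. s \<in> terminal N \<Longrightarrow>
      \<beta> s \<le> (\<Sum>i\<in>I. w i * ((min (z i) (val N s) - min (y i) (val N s)) / (z i - y i)))"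
  shows "\<beta> (initial N) \<le> (\<Sum>i\<in>I. w i * ((local_value N (z i) - local_value N (y i)) / (z i - y i)))"
proof (rule LIMSEQ_le_const)
  show "(\<lambda>m. \<Sum>i\<in>I. w i * ((horizon_value (z i) m (initial N) - horizon_value (y i) m (initial N)) / (z i - y i)))
      \<longlonglongrightarrow> (\<Sum>i\<in>I. w i * ((local_value N (z i) - local_value N (y i)) / (z i - y i)))"
  proof (intro tendsto_intros horizon_value_tendsto_local_value)
    fix i assume "i \<in> I"
    then show "0 \<le> z i" "0 \<le> y i" "z i - y i \<noteq> 0" using I(3)[of i] I(4)[of i] by auto
  qed
  show "\<exists>n0. \<forall>m\<ge>n0. \<beta> (initial N)
      \<le> (\<Sum>i\<in>I. w i * ((horizon_value (z i) m (initial N) - horizon_value (y i) m (initial N)) / (z i - y i)))"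
    using submartingale_le_slopes[OF assms] by blast
qed

end

section \<open>Weighing\<close>

definition consistent :: "history \<Rightarrow> real set" where
  "consistent h = {x. \<forall>(t, b)\<in>set h. (x \<le> t) = b}"

lemma consistent_append: "consistent (h @ [(t, b)]) = {x \<in> consistent h. (x \<le> t) = b}"
  by (auto simp: consistent_def)

lemma consistent_Nil[simp]: "consistent [] = UNIV"
  by (simp add: consistent_def)

lemma conditional_eq: "conditional D h = uniform_measure D (consistent h)"
  by (simp add: conditional_def consistent_def)

section \<open>Measurability of histories and weighing actions\<close>

lemma space_history_space[simp]: "space history_space = UNIV"
  by (simp add: history_space_def)

lemma space_ws_state_space[simp]: "space ws_state_space = UNIV"
  by (simp add: ws_state_space_def space_pair_measure)

lemma space_ws_action_space[simp]: "space ws_action_space = UNIV"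
  by (simp add: ws_action_space_def)

lemma history_coordinates_measurable:
  "(\<lambda>h. (length h, \<lambda>i. if i < length h then h ! i else (0, False)))
    \<in> history_space \<rightarrow>\<^sub>M count_space UNIV \<Otimes>\<^sub>M (\<Pi>\<^sub>M i\<in>UNIV. borel \<Otimes>\<^sub>M count_space UNIV)"
  unfolding history_space_def
  by (rule measurable_vimage_algebra1) (auto simp: space_pair_measure space_PiM)

lemma length_measurable[measurable]: "length \<in> history_space \<rightarrow>\<^sub>M count_space UNIV"
  using measurable_compose[OF history_coordinates_measurable measurable_fst] by simp

lemma history_entry_measurable[measurable]:
  "(\<lambda>h. if i < length h then h ! i else (0, False)) \<in> history_space \<rightarrow>\<^sub>M borel \<Otimes>\<^sub>M count_space UNIV"
  using measurable_compose[OF measurable_compose[OF history_coordinates_measurable measurable_snd]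
      measurable_component_singleton[of i UNIV]] by simp

text \<open>Coordinatewise, appending changes only the entry at position
  \<open>length (f x)\<close>; all others keep their padded value.\<close>

lemma append_measurable:
  assumes f[measurable]: "f \<in> M \<rightarrow>\<^sub>M history_space" and e[measurable]: "e \<in> M \<rightarrow>\<^sub>M borel \<Otimes>\<^sub>M count_space UNIV"
  shows "(\<lambda>x. f x @ [e x]) \<in> M \<rightarrow>\<^sub>M history_space"
  unfolding history_space_def
proof (rule measurable_vimage_algebra2)
  have [measurable]: "(\<lambda>x. length (f x)) \<in> M \<rightarrow>\<^sub>M count_space UNIV"
    using measurable_compose[OF f length_measurable] .
  have "(\<lambda>x. if i < length (f x @ [e x]) then (f x @ [e x]) ! i else (0, False))
      \<in> M \<rightarrow>\<^sub>M borel \<Otimes>\<^sub>M count_space UNIV" for i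
  proof -
    have "(\<lambda>x. if i < length (f x @ [e x]) then (f x @ [e x]) ! i else (0, False))
      = (\<lambda>x. if i = length (f x) then e x else (if i < length (f x) then f x ! i else (0, False)))"
      by (auto simp: nth_append)
    also have "\<dots> \<in> M \<rightarrow>\<^sub>M borel \<Otimes>\<^sub>M count_space UNIV"
      by (rule measurable_If[OF e measurable_compose[OF f history_entry_measurable]]) measurable
    finally show ?thesis .
  qed
  then show "(\<lambda>x. (length (f x @ [e x]), \<lambda>i. if i < length (f x @ [e x]) then (f x @ [e x]) ! i else (0, False)))
    \<in> M \<rightarrow>\<^sub>M count_space UNIV \<Otimes>\<^sub>M (\<Pi>\<^sub>M i\<in>UNIV. borel \<Otimes>\<^sub>M count_space UNIV)"
    by (intro measurable_Pair measurable_PiM_single') (auto simp: space_pair_measure)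
qed auto

text \<open>Through the padded entries \<open>E i\<close>, consistency becomes a countable
  conjunction of conditions measurable jointly in the history and the point.\<close>

lemma consistent_measurable:
  "Measurable.pred (history_space \<Otimes>\<^sub>M borel) (\<lambda>p. snd p \<in> consistent (fst p))"
proof -
  define E where "E i h = (if i < length h then h ! i else (0::real, False))" for i and h :: history
  have [measurable]: "E i \<in> history_space \<rightarrow>\<^sub>M borel \<Otimes>\<^sub>M count_space UNIV" for i
    unfolding E_def by (rule history_entry_measurable)
  have eq: "snd p \<in> consistent (fst p) \<longleftrightarrow>
      (\<forall>i. i < length (fst p) \<longrightarrow> (snd p \<le> fst (E i (fst p))) = snd (E i (fst p)))" for p
    by (auto simp: consistent_def E_def all_set_conv_all_nth split_beta)
  show ?thesis unfolding eq by measurable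
qed

lemma consistent_sets[measurable]: "consistent h \<in> sets borel"
  using measurable_sets[OF measurable_compose[OF measurable_Pair1' consistent_measurable], of h "{True}"]
  by (simp add: vimage_def)

lemma Weigh_vimage_measurable:
  assumes "Weigh -` A \<in> sets borel"
  shows "A \<in> sets ws_action_space"
  unfolding ws_action_space_def using assms by (auto simp: sets_measure_of)

text \<open>A total inverse of \<open>Weigh\<close> with a dummy value at \<open>Stop\<close>, so
  that transitions can be written as one case distinction on measurable functions of the
  action.\<close>

primrec threshold :: "ws_action \<Rightarrow> real" where
  "threshold Stop = 0"
| "threshold (Weigh t) = t"

lemma threshold_measurable[measurable]: "threshold \<in> borel_measurable ws_action_space"
  by (rule measurableI) (auto intro!: Weigh_vimage_measurable simp: vimage_def)

lemma Stop_measurable[measurable]: "Measurable.pred ws_action_space (\<lambda>a. a = Stop)"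
  unfolding pred_def by (auto intro!: Weigh_vimage_measurable simp: vimage_def)

lemma ws_cost_measurable[measurable]: "ws_cost c \<in> borel_measurable ws_action_space"
proof -
  have "ws_cost c = (\<lambda>a. if a = Stop then 0 else c)"
  proof
    fix a show "ws_cost c a = (if a = Stop then 0 else c)" by (cases a) auto
  qed
  then show ?thesis by simp
qed

section \<open>Conditional laws and expectations along a history\<close>

locale ws =
  fixes D :: "real measure" and c :: real
  assumes alternative: "ws_alternative D c"
begin

sublocale D: prob_space D
  using alternative by (simp add: ws_alternative_def)

lemma sets_D[measurable_cong]: "sets D = sets borel"
  using alternative by (simp add: ws_alternative_def)

lemma space_D[simp]: "space D = UNIV"
  using sets_eq_imp_space_eq[OF sets_D] by simp

lemma c_nonneg: "0 \<le> c"
  using alternative by (simp add: ws_alternative_def)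

lemma sets_conditional[measurable_cong]: "sets (conditional D h) = sets borel"
  by (simp add: conditional_eq sets_D)

lemma space_conditional[simp]: "space (conditional D h) = UNIV"
  by (simp add: conditional_eq)

lemma emeasure_conditional:
  "A \<in> sets borel \<Longrightarrow> emeasure (conditional D h) A = emeasure D (consistent h \<inter> A) / emeasure D (consistent h)"
  by (simp add: conditional_eq sets_D)

lemma subprob_space_conditional: "subprob_space (conditional D h)"
proof (rule subprob_spaceI)
  show "emeasure (conditional D h) (space (conditional D h)) \<le> 1"
  proof (cases "emeasure D (consistent h) = 0")
    case False
    then show ?thesis by (simp add: emeasure_conditional ennreal_divide_self less_top[symmetric])
  qed (simp add: emeasure_conditional)
qed simp

lemma conditional_measurable[measurable]: "conditional D \<in> history_space \<rightarrow>\<^sub>M subprob_algebra borel"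
proof (rule measurable_subprob_algebra)
  fix A :: "real set" assume A[measurable]: "A \<in> sets borel"
  note consistent_measurable[measurable]
  have 1: "(\<lambda>h. emeasure D (consistent h \<inter> B)) \<in> borel_measurable history_space"
    if [measurable]: "B \<in> sets borel" for B
  proof (rule D.measurable_emeasure)
    have "Measurable.pred (history_space \<Otimes>\<^sub>M borel) (\<lambda>p. snd p \<in> consistent (fst p) \<inter> B)" by simp
    moreover have "sets (history_space \<Otimes>\<^sub>M D) = sets (history_space \<Otimes>\<^sub>M borel)"
      by (intro sets_pair_measure_cong) (simp_all add: sets_D)
    ultimately show "{x \<in> space (history_space \<Otimes>\<^sub>M D). snd x \<in> consistent (fst x) \<inter> B} \<in> sets (history_space \<Otimes>\<^sub>M D)"
      by (simp add: pred_def space_pair_measure)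
  qed simp
  show "(\<lambda>h. emeasure (conditional D h) A) \<in> borel_measurable history_space"
    unfolding emeasure_conditional[OF A] using 1[OF A] 1[of UNIV] by simp
qed (auto simp: sets_conditional subprob_space_conditional)

definition cond_exp :: "history \<Rightarrow> (real \<Rightarrow> real) \<Rightarrow> real" where
  "cond_exp h g = (\<integral>x. g x \<partial>conditional D h)"

lemma cond_exp_measurable[measurable]:
  "g \<in> borel_measurable borel \<Longrightarrow> (\<lambda>h. cond_exp h g) \<in> borel_measurable history_space"
  unfolding cond_exp_def
  by (rule measurable_compose[OF conditional_measurable integral_measurable_subprob_algebra])

lemma conditional_eq_density:
  assumes "D.prob (consistent h) \<noteq> 0"
  shows "conditional D h = density D (\<lambda>x. ennreal (indicator (consistent h) x / D.prob (consistent h)))"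
  unfolding conditional_eq uniform_measure_def
proof (rule density_cong)
  show "AE x in D. indicator (consistent h) x / emeasure D (consistent h)
      = ennreal (indicator (consistent h) x / D.prob (consistent h))"
    using assms by (auto simp: D.emeasure_eq_measure indicator_def divide_ennreal zero_less_measure_iff
        simp flip: ennreal_1)
qed auto

lemma conditional_null:
  assumes "D.prob (consistent h) = 0"
  shows "AE x in conditional D h. P x"
proof -
  have "emeasure (conditional D h) UNIV = 0"
    using assms by (simp add: emeasure_conditional D.emeasure_eq_measure)
  then have "UNIV \<in> null_sets (conditional D h)"
    by (simp add: null_sets_def sets_conditional)
  then show ?thesis by (rule AE_I') auto
qed

text \<open>Also correct for null histories: the left side integrates over the zero measure and the
  right side is a division by 0, so both are 0.\<close>

lemma cond_exp_eq:
  assumes [measurable]: "g \<in> borel_measurable borel"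
  shows "cond_exp h g = (\<integral>x. indicator (consistent h) x * g x \<partial>D) / D.prob (consistent h)"
proof (cases "D.prob (consistent h) = 0")
  case True
  have "cond_exp h g = (\<integral>x. 0 \<partial>conditional D h)"
    unfolding cond_exp_def by (rule integral_cong_AE) (auto simp: conditional_null[OF True])
  then show ?thesis using True by simp
next
  case False
  show ?thesis
    unfolding cond_exp_def conditional_eq_density[OF False]
    by (subst integral_density) auto
qed

lemma integrable_conditional:
  fixes g :: "real \<Rightarrow> real"
  assumes g: "integrable D g"
  shows "integrable (conditional D h) g"
proof -
  have [measurable]: "g \<in> borel_measurable borel" using borel_measurable_integrable[OF g] by simp
  show ?thesis
  proof (cases "D.prob (consistent h) = 0")
    case True
    have "integrable (conditional D h) g \<longleftrightarrow> integrable (conditional D h) (\<lambda>_. 0::real)"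
      by (rule integrable_cong_AE) (auto simp: conditional_null[OF True])
    then show ?thesis by simp
  next
    case False
    have "integrable D (\<lambda>x. indicator (consistent h) x *\<^sub>R g x)"
      by (rule integrable_mult_indicator[OF _ g]) simp
    then have "integrable D (\<lambda>x. (1 / D.prob (consistent h)) * (indicator (consistent h) x * g x))"
      by simp
    then show ?thesis
      unfolding conditional_eq_density[OF False]
      by (subst integrable_density) (auto simp: mult.commute)
  qed
qed

lemma cond_exp_nonneg:
  assumes "\<And>x. 0 \<le> x \<Longrightarrow> 0 \<le> g x" "g \<in> borel_measurable borel"
  shows "0 \<le> cond_exp h g"
proof -
  have "AE x in D. 0 \<le> x" using alternative by (simp add: ws_alternative_def)
  then have "AE x in D. 0 \<le> indicator (consistent h) x * g x" by eventually_elim (use assms in auto)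
  then have "0 \<le> (\<integral>x. indicator (consistent h) x * g x \<partial>D)" by (rule integral_nonneg_AE)
  then show ?thesis by (simp add: cond_exp_eq[OF assms(2)])
qed

section \<open>Transitions and the martingale property\<close>

lemma weigh_measurable:
  "(\<lambda>x. (h @ [(t, x \<le> t)], False)) \<in> borel \<rightarrow>\<^sub>M ws_state_space"
  unfolding ws_state_space_def by (intro measurable_Pair append_measurable) measurable

lemma ws_trans_measurable:
  "(\<lambda>p. ws_trans D (fst (fst p)) (snd p))
    \<in> ws_state_space \<Otimes>\<^sub>M ws_action_space \<rightarrow>\<^sub>M subprob_algebra ws_state_space"
proof -
  have [measurable]: "fst \<in> ws_state_space \<rightarrow>\<^sub>M history_space"
    unfolding ws_state_space_def by simp
  have eq: "ws_trans D h a = (if a = Stop then return ws_state_space (h, True) else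
      distr (conditional D h) ws_state_space (\<lambda>x. (h @ [(threshold a, x \<le> threshold a)], False)))" for h a
    by (cases a) auto
  show ?thesis
    unfolding eq
  proof (rule measurable_If)
    show "(\<lambda>p. return ws_state_space (fst (fst p), True))
        \<in> ws_state_space \<Otimes>\<^sub>M ws_action_space \<rightarrow>\<^sub>M subprob_algebra ws_state_space"
      by (rule measurable_compose[OF _ return_measurable]) (simp add: ws_state_space_def)
    have "(\<lambda>p. fst (fst (fst p)) @ [(threshold (snd (fst p)), snd p \<le> threshold (snd (fst p)))])
        \<in> (ws_state_space \<Otimes>\<^sub>M ws_action_space) \<Otimes>\<^sub>M borel \<rightarrow>\<^sub>M history_space"
      by (rule append_measurable) measurable
    then have "(\<lambda>p. (fst (fst (fst p)) @ [(threshold (snd (fst p)), snd p \<le> threshold (snd (fst p)))], False))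
        \<in> (ws_state_space \<Otimes>\<^sub>M ws_action_space) \<Otimes>\<^sub>M borel \<rightarrow>\<^sub>M ws_state_space"
      unfolding ws_state_space_def by simp
    then show "(\<lambda>p. distr (conditional D (fst (fst p))) ws_state_space
          (\<lambda>x. (fst (fst p) @ [(threshold (snd p), x \<le> threshold (snd p))], False)))
        \<in> ws_state_space \<Otimes>\<^sub>M ws_action_space \<rightarrow>\<^sub>M subprob_algebra ws_state_space"
      by (intro measurable_distr2[where M=borel]) (auto simp: split_beta)
  qed measurable
qed

lemma ws_trans_measurable_action: "ws_trans D h \<in> ws_action_space \<rightarrow>\<^sub>M subprob_algebra ws_state_space"
  using measurable_compose[OF measurable_Pair1' ws_trans_measurable, of "(h, False)"] by simp

lemma subprob_space_ws_trans: "subprob_space (ws_trans D h a)"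
  using measurable_space[OF ws_trans_measurable_action, of a h] by (simp add: space_subprob_algebra)

lemma cond_exp_state_measurable[measurable]:
  "g \<in> borel_measurable borel \<Longrightarrow> (\<lambda>s. cond_exp (fst s) g) \<in> borel_measurable ws_state_space"
  unfolding ws_state_space_def by simp

text \<open>A weighing has only two possible successors, so the integrand takes at most two
  values.\<close>

lemma integrable_Weigh:
  fixes f :: "history \<times> bool \<Rightarrow> real"
  assumes f: "f \<in> borel_measurable ws_state_space"
  shows "integrable (ws_trans D h (Weigh t)) f"
proof -
  interpret subprob_space "conditional D h" by (rule subprob_space_conditional)
  let ?A = "f (h @ [(t, True)], False)" and ?B = "f (h @ [(t, False)], False)"
  have w: "(\<lambda>x. (h @ [(t, x \<le> t)], False)) \<in> conditional D h \<rightarrow>\<^sub>M ws_state_space"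
    using weigh_measurable measurable_cong_sets[OF sets_conditional refl] by blast
  have "integrable (conditional D h) (\<lambda>x. f (h @ [(t, x \<le> t)], False))"
  proof (rule integrable_const_bound)
    have "norm (f (h @ [(t, x \<le> t)], False)) \<le> max \<bar>?A\<bar> \<bar>?B\<bar>" for x
      by (cases "x \<le> t") simp_all
    then show "AE x in conditional D h. norm (f (h @ [(t, x \<le> t)], False)) \<le> max \<bar>?A\<bar> \<bar>?B\<bar>"
      by (intro AE_I2)
    show "(\<lambda>x. f (h @ [(t, x \<le> t)], False)) \<in> borel_measurable (conditional D h)"
      by (rule measurable_compose[OF w f])
  qed
  then show ?thesis
    unfolding ws_trans.simps by (subst integrable_distr_eq[OF w f])
qed

text \<open>Absolute rather than conditional branch probabilities let null branches and null
  histories fit the same formula.\<close>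

lemma integral_Weigh:
  fixes f :: "history \<times> bool \<Rightarrow> real"
  assumes f: "f \<in> borel_measurable ws_state_space"
  shows "(\<integral>s. f s \<partial>ws_trans D h (Weigh t)) =
    (D.prob (consistent (h @ [(t, True)])) * f (h @ [(t, True)], False)
      + D.prob (consistent (h @ [(t, False)])) * f (h @ [(t, False)], False)) / D.prob (consistent h)"
proof -
  let ?A = "f (h @ [(t, True)], False)" and ?B = "f (h @ [(t, False)], False)"
  have w: "(\<lambda>x. (h @ [(t, x \<le> t)], False)) \<in> conditional D h \<rightarrow>\<^sub>M ws_state_space"
    using weigh_measurable measurable_cong_sets[OF sets_conditional refl] by blast
  have "(\<integral>s. f s \<partial>ws_trans D h (Weigh t)) = cond_exp h (\<lambda>x. f (h @ [(t, x \<le> t)], False))"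
    unfolding cond_exp_def ws_trans.simps by (rule integral_distr[OF w f])
  also have "\<dots> = (\<integral>x. indicator (consistent h) x * f (h @ [(t, x \<le> t)], False) \<partial>D) / D.prob (consistent h)"
    by (rule cond_exp_eq[OF measurable_compose[OF weigh_measurable f]])
  also have "(\<integral>x. indicator (consistent h) x * f (h @ [(t, x \<le> t)], False) \<partial>D)
      = (\<integral>x. indicator (consistent (h @ [(t, True)])) x * ?A + indicator (consistent (h @ [(t, False)])) x * ?B \<partial>D)"
  proof (rule Bochner_Integration.integral_cong[OF refl])
    fix x show "indicator (consistent h) x * f (h @ [(t, x \<le> t)], False)
      = indicator (consistent (h @ [(t, True)])) x * ?A + indicator (consistent (h @ [(t, False)])) x * ?B"
      by (cases "x \<le> t") (simp_all add: consistent_append indicator_def)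
  qed
  also have "\<dots> = D.prob (consistent (h @ [(t, True)])) * ?A + D.prob (consistent (h @ [(t, False)])) * ?B"
  proof (subst Bochner_Integration.integral_add)
    show "integrable D (\<lambda>x. indicator (consistent (h @ [(t, True)])) x * ?A)"
      "integrable D (\<lambda>x. indicator (consistent (h @ [(t, False)])) x * ?B)"
      by (intro integrable_mult_left integrable_real_indicator; simp add: sets_D D.emeasure_eq_measure)+
  qed simp
  finally show ?thesis .
qed

lemma integral_Stop:
  fixes f :: "history \<times> bool \<Rightarrow> real"
  assumes "f \<in> borel_measurable ws_state_space"
  shows "(\<integral>s. f s \<partial>ws_trans D h Stop) = f (h, True)"
  using assms by (simp add: integral_return)

text \<open>The tower property: the two answers of a weighing split the consistent set, and stopping
  reveals nothing.\<close>

lemma cond_exp_martingale: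
  assumes g: "integrable D g"
  shows "(\<integral>s. cond_exp (fst s) g \<partial>ws_trans D h a) = cond_exp h g"
proof -
  have [measurable]: "g \<in> borel_measurable borel" using borel_measurable_integrable[OF g] by simp
  show ?thesis
  proof (cases a)
    case Stop
    then show ?thesis using integral_Stop[of "\<lambda>s. cond_exp (fst s) g"] by simp
  next
    case (Weigh t)
    \<comment> \<open>Unnormalised expectations add up over the two branches; for a null history
      both sides are 0.\<close>
    have *: "D.prob (consistent h) * cond_exp h g = (\<integral>x. indicator (consistent h) x * g x \<partial>D)" for h
    proof (cases "D.prob (consistent h) = 0")
      case True
      then have "AE x in D. x \<notin> consistent h"
        by (subst (asm) D.prob_eq_0) (auto simp: sets_D)
      then have "(\<integral>x. indicator (consistent h) x * g x \<partial>D) = (\<integral>x. 0 \<partial>D)"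
        by (intro integral_cong_AE) auto
      then show ?thesis using True by simp
    qed (simp add: cond_exp_eq)
    have ind: "integrable D (\<lambda>x. indicator (consistent h) x * g x)" for h
      using integrable_mult_indicator[OF _ g, of "consistent h"] by simp
    have "(\<integral>x. indicator (consistent (h @ [(t, True)])) x * g x \<partial>D)
        + (\<integral>x. indicator (consistent (h @ [(t, False)])) x * g x \<partial>D)
        = (\<integral>x. indicator (consistent (h @ [(t, True)])) x * g x
          + indicator (consistent (h @ [(t, False)])) x * g x \<partial>D)"
      using ind by simp
    also have "\<dots> = (\<integral>x. indicator (consistent h) x * g x \<partial>D)"
      by (rule Bochner_Integration.integral_cong) (auto simp: indicator_def consistent_append)
    finally have "(\<integral>x. indicator (consistent (h @ [(t, True)])) x * g x \<partial>D)
        + (\<integral>x. indicator (consistent (h @ [(t, False)])) x * g x \<partial>D)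
        = (\<integral>x. indicator (consistent h) x * g x \<partial>D)" .
    then show ?thesis
      unfolding Weigh integral_Weigh[OF cond_exp_state_measurable[OF \<open>g \<in> borel_measurable borel\<close>]]
        fst_conv * by (simp add: cond_exp_eq)
  qed
qed

lemma ws_mdp_simps[simp]:
  "state_space (ws_mdp D c) = ws_state_space" "action_space (ws_mdp D c) = ws_action_space"
  "initial (ws_mdp D c) = ([], False)" "terminal (ws_mdp D c) = {s. snd s}"
  "val (ws_mdp D c) s = cond_exp (fst s) (\<lambda>x. x)" "action_cost (ws_mdp D c) s a = ws_cost c a"
  "trans (ws_mdp D c) s = ws_trans D (fst s)"
  by (simp_all add: ws_mdp_def cond_exp_def)

lemma ws_cost_bounds: "0 \<le> ws_cost c a" "ws_cost c a \<le> c"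
  using c_nonneg by (cases a; simp)+

sublocale cost_mdp "ws_mdp D c"
  by (rule cost_mdp.intro) (simp_all add: subprob_space_ws_trans ws_cost_bounds cond_exp_nonneg)

section \<open>The committed chain as a bounded chain\<close>

lemma committed_chain_simps[simp]:
  "initial (committed_chain (ws_mdp D c) \<pi>) = ([], False)"
  "terminal (committed_chain (ws_mdp D c) \<pi>) = {s. snd s}"
  "val (committed_chain (ws_mdp D c) \<pi>) s = cond_exp (fst s) (\<lambda>x. x)"
  "action_cost (committed_chain (ws_mdp D c) \<pi>) s u = (\<integral>a. ws_cost c a \<partial>\<pi> s)"
  "trans (committed_chain (ws_mdp D c) \<pi>) s u = \<pi> s \<bind> ws_trans D (fst s)"
  by (simp_all add: committed_chain_def)

context
  fixes \<pi> :: "history \<times> bool \<Rightarrow> ws_action measure"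
  assumes \<pi>: "commitment (ws_mdp D c) \<pi>"
begin

lemma commitment_measurable: "\<pi> \<in> ws_state_space \<rightarrow>\<^sub>M prob_algebra ws_action_space"
  using \<pi> by (simp add: commitment_def)

lemma commitment_prob_space: "prob_space (\<pi> s)" and commitment_sets: "sets (\<pi> s) = sets ws_action_space"
  using measurable_space[OF commitment_measurable, of s] by (auto simp: space_prob_algebra)

lemma ws_trans_measurable_commitment: "ws_trans D h \<in> \<pi> s \<rightarrow>\<^sub>M subprob_algebra ws_state_space"
  using ws_trans_measurable_action[of h] commitment_sets by (simp cong: measurable_cong_sets)

lemma commitment_bounded_chain: "bounded_chain (committed_chain (ws_mdp D c) \<pi>) ws_state_space c"
proof (intro bounded_chain.intro cost_mdp.intro bounded_chain_axioms.intro)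
  fix s :: "history \<times> bool"
  interpret P: prob_space "\<pi> s" by (rule commitment_prob_space)
  have [measurable]: "ws_cost c \<in> borel_measurable (\<pi> s)"
    using ws_cost_measurable[of c] commitment_sets by (simp cong: measurable_cong_sets)
  show "subprob_space (trans (committed_chain (ws_mdp D c) \<pi>) s u)" for u
    using subprob_space_bind[OF P.subprob_space_axioms ws_trans_measurable_commitment] by simp
  show "0 \<le> action_cost (committed_chain (ws_mdp D c) \<pi>) s u" for u
    using ws_cost_bounds by simp
  show "0 \<le> val (committed_chain (ws_mdp D c) \<pi>) s"
    by (simp add: cond_exp_nonneg)
  show "action_cost (committed_chain (ws_mdp D c) \<pi>) s () \<le> c"
    using ws_cost_bounds
    by (auto intro!: P.integral_le_const P.integrable_const_bound[of _ c])
next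
  show "space ws_state_space = UNIV" by simp
  show "(\<lambda>s. trans (committed_chain (ws_mdp D c) \<pi>) s ()) \<in> ws_state_space \<rightarrow>\<^sub>M subprob_algebra ws_state_space"
    using measurable_bind[OF measurable_prob_algebraD[OF commitment_measurable] ws_trans_measurable]
    by simp
  show "terminal (committed_chain (ws_mdp D c) \<pi>) \<in> sets ws_state_space"
  proof -
    have "Measurable.pred ws_state_space (\<lambda>s. snd s)" unfolding ws_state_space_def by simp
    then show ?thesis by (simp add: pred_def)
  qed
  show "val (committed_chain (ws_mdp D c) \<pi>) \<in> borel_measurable ws_state_space"
    using cond_exp_state_measurable[of "\<lambda>x. x"] by (simp add: committed_chain_def ws_mdp_def cond_exp_def)
  show "(\<lambda>s. action_cost (committed_chain (ws_mdp D c) \<pi>) s ()) \<in> borel_measurable ws_state_space"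
    using measurable_compose[OF measurable_prob_algebraD[OF commitment_measurable]
        integral_measurable_subprob_algebra[OF ws_cost_measurable]] by simp
qed

text \<open>Every action preserves the conditional expectation, hence so does a random one;
  boundedness justifies exchanging the integrals.\<close>

lemma commitment_martingale:
  assumes g: "integrable D g" and bound: "\<And>h. \<bar>cond_exp h g\<bar> \<le> b"
  shows "(\<integral>s'. cond_exp (fst s') g \<partial>trans (committed_chain (ws_mdp D c) \<pi>) s u) = cond_exp (fst s) g"
proof -
  have [measurable]: "g \<in> borel_measurable borel" using borel_measurable_integrable[OF g] by simp
  interpret P: prob_space "\<pi> s" by (rule commitment_prob_space)
  have "(\<integral>s'. cond_exp (fst s') g \<partial>(\<pi> s \<bind> ws_trans D (fst s)))
      = (\<integral>a. (\<integral>s'. cond_exp (fst s') g \<partial>ws_trans D (fst s) a) \<partial>\<pi> s)"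
    using bound ws_trans_measurable_commitment
    by (intro integral_bind[where B=b and B'=1 and K=ws_state_space])
       (auto simp: P.finite_measure_axioms intro!: AE_I2 subprob_space.emeasure_space_le_1 subprob_space_ws_trans)
  also have "\<dots> = cond_exp (fst s) g"
    by (simp add: cond_exp_martingale[OF g] P.prob_space)
  finally show ?thesis by simp
qed

end

end

section \<open>The local game of weighing\<close>

context ws
begin

lemma cond_exp_Nil: "g \<in> borel_measurable borel \<Longrightarrow> cond_exp [] g = (\<integral>x. g x \<partial>D)"
  using D.prob_space by (simp add: cond_exp_eq)

lemma integrable_identity: "integrable D (\<lambda>x. x)"
  using alternative by (simp add: ws_alternative_def)

lemma integrable_min: "integrable D (\<lambda>x. min x y)"
  by (intro integrable_min integrable_identity) simp

text \<open>Jensen's inequality for the concave map \<open>x -> min x y\<close>;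
  \<open>0 <= y\<close> covers conditional measures of mass below 1.\<close>

lemma cond_exp_min_le:
  assumes "0 \<le> y"
  shows "cond_exp h (\<lambda>x. min x y) \<le> min y (cond_exp h (\<lambda>x. x))"
proof -
  interpret subprob_space "conditional D h" by (rule subprob_space_conditional)
  have "cond_exp h (\<lambda>x. min x y) \<le> cond_exp h (\<lambda>x. x)"
    unfolding cond_exp_def
    by (intro integral_mono integrable_conditional integrable_identity integrable_min) simp
  moreover have "cond_exp h (\<lambda>x. min x y) \<le> (\<integral>x. y \<partial>conditional D h)"
    unfolding cond_exp_def
    by (intro integral_mono integrable_conditional integrable_min) simp_all
  moreover have "(\<integral>x. y \<partial>conditional D h) \<le> y"
    using assms subprob_measure_le_1[of UNIV] by (simp add: mult_left_le_one_le)
  ultimately show ?thesis by simp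
qed

text \<open>Once \<open>c\<close> has been paid, the conditional expectation of
  \<open>min x y\<close> is a martingale below every later cost, so further weighings cannot help. A
  stopped state offers only \<open>y\<close> or the conditional mean.\<close>

lemma ws_total_cost_ge:
  assumes y: "0 \<le> y" and "admissible (ws_mdp D c) p s"
  shows "(if snd s then min y (cond_exp (fst s) (\<lambda>x. x))
      else min (min y (cond_exp (fst s) (\<lambda>x. x))) (c + cond_exp (fst s) (\<lambda>x. min x y)))
    \<le> total_cost (ws_mdp D c) y p s"
  using assms(2)
proof (induction p arbitrary: s)
  case (Advance a k)
  obtain h where s: "s = (h, False)" using Advance.prems by (cases s) auto
  have IH: "(if snd s' then min y (cond_exp (fst s') (\<lambda>x. x))
      else min (min y (cond_exp (fst s') (\<lambda>x. x))) (c + cond_exp (fst s') (\<lambda>x. min x y)))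
    \<le> total_cost (ws_mdp D c) y (k s') s'" for s'
  proof (rule Advance.IH[OF rangeI])
    show "admissible (ws_mdp D c) (k s') s'" using Advance.prems unfolding admissible.simps by blast
  qed
  have int: "integrable (ws_trans D h a) (\<lambda>s'. total_cost (ws_mdp D c) y (k s') s')"
    using Advance.prems s by simp
  show ?case
  proof (cases a)
    case Stop
    have "(\<lambda>s'. total_cost (ws_mdp D c) y (k s') s') \<in> borel_measurable ws_state_space"
      using borel_measurable_integrable[OF int] Stop by simp
    from integral_Stop[OF this, of h] show ?thesis
      using IH[of "(h, True)"] s Stop by simp
  next
    case (Weigh t)
    have "cond_exp h (\<lambda>x. min x y) = (\<integral>s'. cond_exp (fst s') (\<lambda>x. min x y) \<partial>ws_trans D h a)"
      by (rule cond_exp_martingale[OF integrable_min, symmetric])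
    also have "\<dots> \<le> (\<integral>s'. total_cost (ws_mdp D c) y (k s') s' \<partial>ws_trans D h a)"
    proof (rule integral_mono)
      show "integrable (ws_trans D h a) (\<lambda>s'. cond_exp (fst s') (\<lambda>x. min x y))"
        unfolding Weigh by (rule integrable_Weigh) simp
      fix s'
      show "cond_exp (fst s') (\<lambda>x. min x y) \<le> total_cost (ws_mdp D c) y (k s') s'"
        using IH[of s'] cond_exp_min_le[OF y, of "fst s'"] c_nonneg by (auto split: if_splits)
    qed (rule int)
    finally show ?thesis using s Weigh by simp
  qed
qed (auto simp: min_le_iff_disj)

lemma ws_local_value_ge:
  assumes "0 \<le> y"
  shows "min (min y (\<integral>x. x \<partial>D)) (c + (\<integral>x. min x y \<partial>D)) \<le> local_value (ws_mdp D c) y"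
proof (rule local_value_greatest)
  fix p assume "admissible (ws_mdp D c) p (initial (ws_mdp D c))"
  from ws_total_cost_ge[OF assms this]
  show "min (min y (\<integral>x. x \<partial>D)) (c + (\<integral>x. min x y \<partial>D)) \<le> total_cost (ws_mdp D c) y p (initial (ws_mdp D c))"
    by (simp add: cond_exp_Nil)
qed

text \<open>After \<open>Stop\<close> the state is terminal. The other branch exists because
  \<open>admissible\<close> inspects all states and forbids \<open>Accept\<close> at nonterminal
  ones.\<close>

definition stop_policy :: "(history \<times> bool, ws_action) policy" where
  "stop_policy = Advance Stop (\<lambda>s. if snd s then Accept else Take_Outside)"

lemma stop_policy:
  shows "admissible (ws_mdp D c) stop_policy (h, False)"
    and "total_cost (ws_mdp D c) y stop_policy (h, False) = cond_exp h (\<lambda>x. x)"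
proof -
  have [measurable]: "Measurable.pred ws_state_space snd" unfolding ws_state_space_def by simp
  let ?T = "\<lambda>y s. total_cost (ws_mdp D c) y (if snd s then Accept else Take_Outside) s"
  have T: "?T y = (\<lambda>s. if snd s then cond_exp (fst s) (\<lambda>x. x) else y)" for y by auto
  have m: "?T y \<in> borel_measurable ws_state_space" for y unfolding T by measurable
  have "integrable (return ws_state_space (h, True)) (?T y)" for y
    using m[of y] by (intro integrableI_bounded) (auto simp: nn_integral_return)
  then show "admissible (ws_mdp D c) stop_policy (h, False)" by (simp add: stop_policy_def)
  show "total_cost (ws_mdp D c) y stop_policy (h, False) = cond_exp h (\<lambda>x. x)"
    using integral_Stop[OF m[of y], of h] by (simp add: stop_policy_def)
qed

lemma ws_local_value_le_mean: "local_value (ws_mdp D c) y \<le> (\<integral>x. x \<partial>D)"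
  using local_value_le[of stop_policy y] stop_policy(1)[of "[]"] stop_policy(2)[of y "[]"] by (simp add: cond_exp_Nil)

text \<open>The bound is the cost of weighing against \<open>y\<close> and then accepting if
  \<open>X <= y\<close>, and taking the outside option otherwise.\<close>

lemma ws_local_value_le_weigh: "local_value (ws_mdp D c) y \<le> c + (\<integral>x. min x y \<partial>D)"
proof -
  \<comment> \<open>The answer to the first weighing, read through a padded coordinate whose
    measurability is known.\<close>
  define ok where "ok h = snd (if 0 < length h then h ! 0 else (0::real, False))" for h :: history
  have [measurable]: "Measurable.pred history_space ok"
    unfolding ok_def using measurable_compose[OF history_entry_measurable[of 0] measurable_snd] by simp
  have [measurable]: "Measurable.pred ws_state_space snd" "fst \<in> ws_state_space \<rightarrow>\<^sub>M history_space"
    unfolding ws_state_space_def by simp_all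
  define k :: "history \<times> bool \<Rightarrow> (history \<times> bool, ws_action) policy" where
    "k s = (if snd s then Accept else if ok (fst s) then stop_policy else Take_Outside)" for s
  have T: "total_cost (ws_mdp D c) x (k s) s = (if snd s \<or> ok (fst s) then cond_exp (fst s) (\<lambda>x. x) else x)"
    for x s
    using stop_policy(2)[of x "fst s"] by (cases s) (auto simp: k_def)
  have m: "(\<lambda>s. total_cost (ws_mdp D c) x (k s) s) \<in> borel_measurable ws_state_space" for x
    unfolding T by measurable
  have "admissible (ws_mdp D c) (k s) s" for s
    using stop_policy(1)[of "fst s"] by (cases s) (auto simp: k_def)
  then have adm: "admissible (ws_mdp D c) (Advance (Weigh y) k) ([], False)"
    using integrable_Weigh[OF m, of "[]" y] by simp
  have i1: "integrable D (\<lambda>x. indicator {..y} x * x)"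
    using integrable_mult_indicator[OF _ integrable_identity, of "{..y}"] by (simp add: sets_D)
  have i2: "integrable D (\<lambda>x. indicator {y<..} x * y)"
    by (intro integrable_mult_left integrable_real_indicator) (simp_all add: sets_D D.emeasure_eq_measure)
  have cons: "consistent [(y, True)] = {..y}" "consistent [(y, False)] = {y<..}"
    by (auto simp: consistent_def)
  \<comment> \<open>If \<open>X <= y\<close> has probability 0, the conditional mean is a default
    value, but the product is still right.\<close>
  have null: "D.prob {..y} * cond_exp [(y, True)] (\<lambda>x. x) = (\<integral>x. indicator {..y} x * x \<partial>D)"
  proof (cases "D.prob {..y} = 0")
    case True
    then have "AE x in D. x \<notin> {..y}"
      by (subst (asm) D.prob_eq_0) (auto simp: sets_D)
    then have "(\<integral>x. indicator {..y} x * x \<partial>D) = (\<integral>x. 0 \<partial>D)"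
      by (intro integral_cong_AE) (auto simp: sets_D measurable_cong_sets[OF sets_D refl])
    then show ?thesis using True by simp
  qed (simp add: cond_exp_eq cons)
  have "local_value (ws_mdp D c) y \<le> total_cost (ws_mdp D c) y (Advance (Weigh y) k) ([], False)"
    using local_value_le[of "Advance (Weigh y) k" y] adm by simp
  also have "\<dots> = c + (\<integral>s. total_cost (ws_mdp D c) y (k s) s \<partial>ws_trans D [] (Weigh y))"
    by simp
  also have "(\<integral>s. total_cost (ws_mdp D c) y (k s) s \<partial>ws_trans D [] (Weigh y))
      = D.prob {..y} * cond_exp [(y, True)] (\<lambda>x. x) + D.prob {y<..} * y"
    by (subst integral_Weigh[OF m]) (use D.prob_space in \<open>simp add: T ok_def cons\<close>)
  also have "\<dots> = (\<integral>x. indicator {..y} x * x + indicator {y<..} x * y \<partial>D)"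
    unfolding null using i1 i2 by (simp add: sets_D)
  also have "\<dots> = (\<integral>x. min x y \<partial>D)"
    by (rule Bochner_Integration.integral_cong) (auto simp: indicator_def min_def)
  finally show ?thesis .
qed

end

section \<open>Exponentially spread values\<close>

text \<open>\<open>\<eta>\<close> raises the conditional mean given \<open>X >= R ^ j\<close> to at
  least \<open>R ^ j / \<eta> = 6 * \<alpha> * R ^ j\<close> for \<open>1 <= j <= N\<close>. The
  bound on \<open>N\<close> makes \<open>N * \<eta> / 2 >= 6 * \<alpha>\<close>, which serves
  \<open>j = 0\<close>. \<open>R\<close> separates the values of \<open>X\<close> and exceeds the
  number \<open>N\<close> of nonzero slope bounds.\<close>

locale hard_instance =
  fixes \<alpha> R \<eta> :: real and N :: nat
  assumes \<alpha>: "1 \<le> \<alpha>" and \<eta>_def: "\<eta> = 1 / (6 * \<alpha>)"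
    and N: "1 + 72 * \<alpha>\<^sup>2 \<le> real N" and R_def: "R = 4 * real N"
begin

lemma \<eta>: "0 < \<eta>" "\<eta> \<le> 1" "6 * \<alpha> * \<eta> = 1"
  using \<alpha> by (auto simp: \<eta>_def)

lemma N_pos: "0 < N" "73 \<le> real N"
proof -
  have "1 \<le> \<alpha>\<^sup>2" using \<alpha> by simp
  then show "73 \<le> real N" using N by simp
  then show "0 < N" by simp
qed

lemma \<alpha>_le_square: "\<alpha> \<le> \<alpha>\<^sup>2"
  using \<alpha> by (simp add: power2_eq_square)

lemma R: "292 \<le> R" "6 * \<alpha> \<le> R" "real N + 2 \<le> R" "real N < R" "24 * \<alpha> \<le> R"
  using N_pos N \<alpha>_le_square \<alpha> unfolding R_def by auto

lemma R_nonzero[simp]: "R \<noteq> 0"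
  using R(1) by auto

lemma \<eta>_R: "4 \<le> \<eta> * R"
  using R(5) \<alpha> by (simp add: \<eta>_def field_simps)

lemma power_R: "1 \<le> R ^ k" "0 < R ^ k"
  using R(1) by (auto intro: one_le_power)

text \<open>Meant as \<open>Pr[X >= R ^ k]\<close>. The middle tails carry the small factor
  \<open>\<eta>\<close>, which raises conditional means; the last one lacks it, so that the largest
  value contributes exactly the weighing cost 1 to the mean.\<close>

definition tail :: "nat \<Rightarrow> real" where
  "tail k = (if k = 0 then 1 else if k \<le> N then \<eta> / R ^ k else if k = Suc N then 1 / R ^ k else 0)"

definition weight :: "nat \<Rightarrow> real" where
  "weight k = tail k - tail (Suc k)"

lemma tail_pos: "k \<le> Suc N \<Longrightarrow> 0 < tail k"
  using \<eta> power_R(2) by (auto simp: tail_def)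

text \<open>This fails at \<open>k = N\<close>, where the factor \<open>\<eta>\<close> disappears;
  the top slope is therefore treated separately.\<close>

lemma tail_Suc_le: "k < N \<Longrightarrow> tail (Suc k) \<le> tail k / R"
  using \<eta> R by (auto simp: tail_def divide_right_mono mult.commute)

lemma weight_nonneg: "0 \<le> weight k"
proof -
  consider "k = 0" | "0 < k" "k < N" | "k = N" | "k = Suc N" | "Suc N < k" by linarith
  then show ?thesis
  proof cases
    case 1
    then show ?thesis using N_pos \<eta> R by (simp add: weight_def tail_def)
  next
    case 2
    have "tail (Suc k) \<le> tail k / R" using tail_Suc_le 2 by simp
    also have "\<dots> \<le> tail k" using R tail_pos[of k] 2 by (simp add: field_simps)
    finally show ?thesis by (simp add: weight_def)
  next
    case 3
    then show ?thesis using N_pos \<eta>_R power_R(2)[of N] R by (simp add: weight_def tail_def field_simps)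
  next
    case 4
    then show ?thesis using power_R(2)[of "Suc N"] by (simp add: weight_def tail_def)
  qed (simp add: weight_def tail_def)
qed

lemma sum_weight:
  assumes "k \<le> Suc N"
  shows "(\<Sum>i\<in>{k..Suc N}. weight i) = tail k"
proof -
  have "(\<Sum>i\<in>{k..Suc N}. weight i) = - (\<Sum>i\<in>{k..Suc N}. tail (Suc i) - tail i)"
    unfolding weight_def by (simp add: sum_negf[symmetric])
  also have "(\<Sum>i\<in>{k..Suc N}. tail (Suc i) - tail i) = tail (Suc (Suc N)) - tail k"
    using assms by (intro sum_Suc_diff) simp
  finally show ?thesis by (simp add: tail_def)
qed

lemma tail_le_1: "k \<le> Suc N \<Longrightarrow> tail k \<le> 1"
  using sum_weight[of k] sum_weight[of 0] weight_nonneg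
    sum_mono2[of "{0..Suc N}" "{k..Suc N}" weight] by (simp add: tail_def del: sum.cl_ivl_Suc)

lemma weight_last: "weight (Suc N) * R ^ Suc N = 1" "weight (Suc N) = tail (Suc N)"
  using power_R(2)[of "Suc N"] by (simp_all add: weight_def tail_def)

lemma weight_power_le:
  assumes "0 < k" "k \<le> N"
  shows "weight k * R ^ k \<le> \<eta>"
proof -
  have "weight k \<le> tail k" using tail_pos[of "Suc k"] assms by (simp add: weight_def)
  then have "weight k * R ^ k \<le> tail k * R ^ k" using power_R(2)[of k] by (intro mult_right_mono) auto
  also have "\<dots> = \<eta>" using assms power_R(2)[of k] by (simp add: tail_def)
  finally show ?thesis .
qed

text \<open>The next tail removes at most half of \<open>tail k\<close>: the ratio is
  \<open>1 / R\<close> below \<open>N\<close> and \<open>1 / (\<eta> * R) <= 1 / 4\<close> at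
  \<open>N\<close>.\<close>

lemma weight_power_ge:
  assumes "0 < k" "k \<le> N"
  shows "\<eta> / 2 \<le> weight k * R ^ k"
proof -
  have "tail (Suc k) * R ^ k \<le> \<eta> / 2"
  proof (cases "k < N")
    case True
    have "tail (Suc k) * R ^ k = \<eta> / R" using True power_R(2)[of k] by (simp add: tail_def)
    also have "\<dots> \<le> \<eta> / 2" using R \<eta> by (intro divide_left_mono) auto
    finally show ?thesis .
  next
    case False
    then have "tail (Suc k) * R ^ k = 1 / R" using assms power_R(2)[of k] by (simp add: tail_def)
    also have "\<dots> \<le> \<eta> / 2" using \<eta>_R R by (simp add: field_simps)
    finally show ?thesis .
  qed
  moreover have "tail k * R ^ k = \<eta>" using assms power_R(2)[of k] by (simp add: tail_def)
  ultimately show ?thesis by (simp add: weight_def algebra_simps)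
qed

section \<open>The law of \<open>X\<close> as a finitely supported measure\<close>

definition X_law :: "real measure" where
  "X_law = distr (point_measure {..Suc N} (\<lambda>i. ennreal (weight i))) borel (\<lambda>i. R ^ i)"

lemma sets_X_law: "sets X_law = sets borel"
  by (simp add: X_law_def)

lemma X_law_integral:
  fixes g :: "real \<Rightarrow> real"
  assumes "g \<in> borel_measurable borel"
  shows "integrable X_law g" "(\<integral>x. g x \<partial>X_law) = (\<Sum>i\<le>Suc N. weight i * g (R ^ i))"
proof -
  have m: "(\<lambda>i. R ^ i) \<in> point_measure {..Suc N} (\<lambda>i. ennreal (weight i)) \<rightarrow>\<^sub>M borel"
    by (simp add: measurable_point_measure_eq1)
  show "integrable X_law g"
    unfolding X_law_def by (subst integrable_distr_eq[OF m assms]) (rule integrable_point_measure_finite, simp)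
  show "(\<integral>x. g x \<partial>X_law) = (\<Sum>i\<le>Suc N. weight i * g (R ^ i))"
    unfolding X_law_def integral_distr[OF m assms]
    by (subst lebesgue_integral_point_measure_finite) (auto simp: weight_nonneg)
qed

lemma prob_space_X_law: "prob_space X_law"
  unfolding X_law_def
proof (rule prob_space.prob_space_distr)
  have "(\<Sum>i\<le>Suc N. weight i) = 1"
    using sum_weight[of 0] by (simp add: atLeast0AtMost tail_def)
  then show "prob_space (point_measure {..Suc N} (\<lambda>i. ennreal (weight i)))"
    by (intro prob_spaceI)
       (simp add: space_point_measure emeasure_point_measure_finite sum_ennreal weight_nonneg del: sum.atMost_Suc)
qed (simp add: measurable_point_measure_eq1)

sublocale ws X_law 1
proof
  have "AE x in X_law. 0 \<le> x"
    unfolding X_law_def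
    using power_R(2) by (subst AE_distr_iff) (auto simp: measurable_point_measure_eq1 intro!: AE_I2 less_imp_le)
  then show "ws_alternative X_law 1"
    using X_law_integral(1)[of "\<lambda>x. x"] prob_space_X_law sets_X_law by (simp add: ws_alternative_def)
qed

lemma power_le_iff: "R ^ i \<le> R ^ j \<longleftrightarrow> i \<le> j"
  using R(1) by (intro power_increasing_iff) auto

text \<open>The levels \<open>3 * R ^ k\<close> and \<open>4 * R ^ k\<close> thus fall strictly
  between consecutive values of \<open>X\<close>.\<close>

lemma power_gap: "i < j \<Longrightarrow> 292 * R ^ i \<le> R ^ j"
proof -
  assume "i < j"
  have "292 * R ^ i \<le> R * R ^ i" using R(1) power_R(2)[of i] by (intro mult_right_mono) auto
  also have "\<dots> = R ^ Suc i" by simp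
  also have "\<dots> \<le> R ^ j" using \<open>i < j\<close> by (subst power_le_iff) simp
  finally show ?thesis .
qed

section \<open>Slopes of the local value of the hard instance\<close>

abbreviation "mean_min y \<equiv> \<integral>x. min x y \<partial>X_law"
abbreviation "mean \<equiv> \<integral>x. x \<partial>X_law"

lemma sum_weight_step:
  assumes "k \<le> N"
  shows "(\<Sum>i\<le>Suc N. weight i * (if i \<le> k then 0 else b)) = b * tail (Suc k)"
proof -
  have "(\<Sum>i\<le>Suc N. weight i * (if i \<le> k then 0 else b)) = (\<Sum>i\<in>{Suc k..Suc N}. weight i * b)"
    using assms by (intro sum.mono_neutral_cong_right) auto
  also have "\<dots> = b * tail (Suc k)"
    unfolding sum_distrib_right[symmetric] using sum_weight[of "Suc k"] assms by simp
  finally show ?thesis .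
qed

text \<open>No value of \<open>X\<close> lies between the two levels, so exactly the values from
  \<open>R ^ (k + 1)\<close> on contribute, each by \<open>R ^ k\<close>.\<close>

lemma mean_min_diff:
  assumes "k \<le> N"
  shows "mean_min (4 * R ^ k) - mean_min (3 * R ^ k) = R ^ k * tail (Suc k)"
proof -
  have "mean_min (4 * R ^ k) - mean_min (3 * R ^ k)
      = (\<Sum>i\<le>Suc N. weight i * (min (R ^ i) (4 * R ^ k) - min (R ^ i) (3 * R ^ k)))"
    by (simp add: X_law_integral(2) right_diff_distrib sum_subtractf del: sum.atMost_Suc)
  also have "\<dots> = (\<Sum>i\<le>Suc N. weight i * (if i \<le> k then 0 else R ^ k))"
  proof (intro sum.cong refl arg_cong2[of _ _ _ _ "(*)"])
    fix i
    show "min (R ^ i) (4 * R ^ k) - min (R ^ i) (3 * R ^ k) = (if i \<le> k then 0 else R ^ k)"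
      using power_le_iff[of i k] power_gap[of k i] power_R(2)[of k] by (auto simp: min_def)
  qed
  finally show ?thesis using sum_weight_step[OF assms] by simp
qed

text \<open>One weighing is no worse than the outside option: the truncated mean is at most
  \<open>R ^ k + 2 * R ^ k * tail (Suc k) <= 2 * R ^ k\<close>, and the weighing cost 1 is at most
  \<open>R ^ k\<close>.\<close>

lemma mean_min_le:
  assumes "k < N"
  shows "1 + mean_min (3 * R ^ k) \<le> 3 * R ^ k"
proof -
  have "mean_min (3 * R ^ k) \<le> (\<integral>x. R ^ k + (min x (3 * R ^ k) - min x (R ^ k)) \<partial>X_law)"
    by (intro integral_mono X_law_integral) simp_all
  also have "\<dots> = (\<Sum>i\<le>Suc N. weight i * (R ^ k + (min (R ^ i) (3 * R ^ k) - min (R ^ i) (R ^ k))))"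
    by (rule X_law_integral) simp
  also have "\<dots> = (\<Sum>i\<le>Suc N. weight i * (R ^ k + (if i \<le> k then 0 else 2 * R ^ k)))"
  proof (intro sum.cong refl arg_cong2[of _ _ _ _ "(*)"] arg_cong2[of _ _ _ _ "(+)"])
    fix i
    show "min (R ^ i) (3 * R ^ k) - min (R ^ i) (R ^ k) = (if i \<le> k then 0 else 2 * R ^ k)"
      using power_le_iff[of i k] power_gap[of k i] power_R(2)[of k] by (auto simp: min_def)
  qed
  also have "\<dots> = (\<Sum>i\<le>Suc N. weight i) * R ^ k + 2 * R ^ k * tail (Suc k)"
    using sum_weight_step[of k "2 * R ^ k"] assms
    by (simp add: distrib_left sum.distrib sum_distrib_right del: sum.atMost_Suc)
  also have "\<dots> = R ^ k + 2 * R ^ k * tail (Suc k)"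
    using sum_weight[of 0] by (simp add: atLeast0AtMost tail_def del: sum.atMost_Suc)
  also have "2 * R ^ k * tail (Suc k) \<le> R ^ k"
  proof -
    have "tail k \<le> 1" using tail_le_1 assms by simp
    then have "tail k / R \<le> 1 / R" using R by (intro divide_right_mono) auto
    also have "1 / R \<le> 1 / 2" using R by (intro divide_left_mono) auto
    finally have "tail (Suc k) \<le> 1 / 2" using tail_Suc_le[OF assms] by linarith
    then have "2 * R ^ k * tail (Suc k) \<le> 2 * R ^ k * (1 / 2)"
      using power_R(2)[of k] by (intro mult_left_mono) auto
    then show ?thesis by simp
  qed
  finally show ?thesis using power_R(1)[of k] by simp
qed

lemma mean_diff: "mean - mean_min y = (\<Sum>i\<le>Suc N. weight i * (R ^ i - min (R ^ i) y))"
  by (simp add: X_law_integral(2) right_diff_distrib sum_subtractf del: sum.atMost_Suc)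

text \<open>One weighing is no worse than stopping at once. The largest value saves 1 up to an error
  of \<open>\<eta> / 8\<close>, and the value \<open>R ^ (k + 1)\<close>, a middle one as
  \<open>k < N\<close>, makes up for that error.\<close>

lemma mean_min_le_mean:
  assumes "k < N"
  shows "1 + mean_min (3 * R ^ k) \<le> mean"
proof -
  let ?a = "\<lambda>i. weight i * (R ^ i - min (R ^ i) (3 * R ^ k))"
  have Rk: "0 < R ^ k" by (rule power_R)
  have "1 - 1 / 4 * \<eta> / 2 \<le> ?a (Suc N)"
  proof -
    have "R ^ k * R \<le> R ^ N" using assms power_le_iff[of "Suc k" N] by (simp add: mult.commute)
    then have "R ^ k * R * R \<le> R ^ N * R" using R by (intro mult_right_mono) auto
    then have "3 * R ^ k / R ^ Suc N \<le> 3 / R\<^sup>2"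
      using R power_R(2)[of N] by (simp add: field_simps power2_eq_square)
    also have "3 / R\<^sup>2 \<le> 1 / 4 * \<eta> / 2"
    proof -
      have "24 \<le> \<eta> * R * R" using \<eta>_R R mult_mono[of 4 "\<eta> * R" 292 R] by simp
      then show ?thesis using R by (simp add: field_simps power2_eq_square)
    qed
    finally have "weight (Suc N) * (3 * R ^ k) \<le> 1 / 4 * \<eta> / 2"
      using weight_last by (simp add: tail_def)
    moreover have "3 * R ^ k \<le> R ^ Suc N"
      using power_gap[of k "Suc N"] assms Rk by simp
    ultimately show ?thesis using weight_last(1) by (simp add: min_def right_diff_distrib)
  qed
  moreover have "1 / 4 * \<eta> / 2 \<le> ?a (Suc k)"
  proof -
    have gap: "292 * R ^ k \<le> R ^ Suc k" by (rule power_gap) simp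
    have "1 / 4 * (\<eta> / 2) \<le> 1 / 4 * (weight (Suc k) * R ^ Suc k)"
      using weight_power_ge[of "Suc k"] assms by (intro mult_left_mono) auto
    also have "\<dots> = weight (Suc k) * (1 / 4 * R ^ Suc k)" by simp
    also have "\<dots> \<le> ?a (Suc k)"
      using gap Rk weight_nonneg[of "Suc k"] by (intro mult_left_mono) (auto simp: min_def)
    finally show ?thesis by simp
  qed
  moreover have "?a (Suc k) + ?a (Suc N) \<le> (\<Sum>i\<le>Suc N. ?a i)"
  proof -
    have "?a (Suc k) + ?a (Suc N) = (\<Sum>i\<in>{Suc k, Suc N}. ?a i)" using assms by simp
    also have "\<dots> \<le> (\<Sum>i\<le>Suc N. ?a i)"
      using assms weight_nonneg by (intro sum_mono2) auto
    finally show ?thesis .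
  qed
  ultimately show ?thesis using mean_diff[of "3 * R ^ k"] by simp
qed

text \<open>Each of the \<open>N + 2\<close> values contributes at most 1, so at the top level
  stopping at once is no worse than the outside option.\<close>

lemma mean_le: "mean \<le> 3 * R ^ N"
proof -
  have "mean = (\<Sum>i\<le>Suc N. weight i * R ^ i)" by (rule X_law_integral) simp
  also have "\<dots> \<le> (\<Sum>i\<le>Suc N. 1)"
  proof (rule sum_mono)
    fix i assume i: "i \<in> {..Suc N}"
    consider "i = 0" | "0 < i" "i \<le> N" | "i = Suc N" using i by fastforce
    then show "weight i * R ^ i \<le> 1"
    proof cases
      case 1
      then show ?thesis using tail_pos[of 1] by (simp add: weight_def tail_def)
    qed (use weight_power_le[of i] \<eta> weight_last in auto)
  qed
  also have "\<dots> \<le> R" using R(3) by simp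
  also have "R \<le> R ^ N" using power_le_iff[of 1 N] N_pos by simp
  finally show ?thesis using power_R(2)[of N] by simp
qed

text \<open>Only the largest value exceeds \<open>3 * R ^ N\<close>, and its contribution to the
  mean is 1, so at this level weighing saves no more than it costs.\<close>

lemma mean_le_mean_min: "mean \<le> 1 + mean_min (3 * R ^ N)"
proof -
  have "(\<Sum>i\<le>Suc N. weight i * (R ^ i - min (R ^ i) (3 * R ^ N)))
      \<le> (\<Sum>i\<le>Suc N. weight i * (if i \<le> N then 0 else R ^ Suc N))"
  proof (intro sum_mono mult_left_mono weight_nonneg)
    fix i assume "i \<in> {..Suc N}"
    then show "R ^ i - min (R ^ i) (3 * R ^ N) \<le> (if i \<le> N then 0 else R ^ Suc N)"
      using power_le_iff[of i N] power_R(2)[of N] power_R(2)[of i] by (auto simp: min_def le_Suc_eq)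
  qed
  also have "\<dots> = 1" using sum_weight_step[of N "R ^ Suc N"] weight_last by (simp add: mult.commute)
  finally show ?thesis using mean_diff[of "3 * R ^ N"] by simp
qed

text \<open>Weighing once is optimal at \<open>3 * R ^ k\<close> and available at
  \<open>4 * R ^ k\<close>, so the increment is at most that of the truncated mean.\<close>

lemma local_value_diff:
  assumes "k < N"
  shows "local_value (ws_mdp X_law 1) (4 * R ^ k) - local_value (ws_mdp X_law 1) (3 * R ^ k)
    \<le> (4 * R ^ k - 3 * R ^ k) * tail (Suc k)"
proof -
  have "1 + mean_min (3 * R ^ k) \<le> local_value (ws_mdp X_law 1) (3 * R ^ k)"
    using ws_local_value_ge[of "3 * R ^ k"] mean_min_le[OF assms] mean_min_le_mean[OF assms] power_R(2)[of k]
    by simp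
  then show ?thesis
    using ws_local_value_le_weigh[of "4 * R ^ k"] mean_min_diff[of k] assms by simp
qed

text \<open>At \<open>3 * R ^ N\<close> the local value has already reached its upper bound, the
  mean.\<close>

lemma local_value_diff_top:
  "local_value (ws_mdp X_law 1) (4 * R ^ N) - local_value (ws_mdp X_law 1) (3 * R ^ N)
    \<le> (4 * R ^ N - 3 * R ^ N) * 0"
  using ws_local_value_ge[of "3 * R ^ N"] ws_local_value_le_mean[of "4 * R ^ N"]
    mean_le mean_le_mean_min power_R(2)[of N] by simp

text \<open>Every answer cuts out a half-line, so the consistent points form an interval. As it
  contains the largest value of \<open>X\<close>, it meets the support in a final segment.\<close>

lemma cond_exp_consistent:
  assumes top: "R ^ Suc N \<in> consistent h"
  obtains j where "j \<le> Suc N"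
    "\<And>g. g \<in> borel_measurable borel \<Longrightarrow> cond_exp h g = (\<Sum>i\<in>{j..Suc N}. weight i * g (R ^ i)) / tail j"
proof
  define j where "j = (LEAST i. R ^ i \<in> consistent h)"
  show j: "j \<le> Suc N" unfolding j_def using top by (rule Least_le)
  have Rj: "R ^ j \<in> consistent h" unfolding j_def using top by (rule LeastI)
  have iff: "R ^ i \<in> consistent h \<longleftrightarrow> j \<le> i" if "i \<le> Suc N" for i
  proof
    assume "R ^ i \<in> consistent h"
    then show "j \<le> i" unfolding j_def by (rule Least_le)
  next
    assume "j \<le> i"
    then have "R ^ j \<le> R ^ i" "R ^ i \<le> R ^ Suc N" using that power_le_iff by blast+
    then show "R ^ i \<in> consistent h"
      using Rj top unfolding consistent_def by (fastforce simp del: power_Suc)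
  qed
  have sum: "(\<integral>x. indicator (consistent h) x * g x \<partial>X_law) = (\<Sum>i\<in>{j..Suc N}. weight i * g (R ^ i))"
    if [measurable]: "g \<in> borel_measurable borel" for g
  proof -
    have "(\<integral>x. indicator (consistent h) x * g x \<partial>X_law)
        = (\<Sum>i\<le>Suc N. weight i * (indicator (consistent h) (R ^ i) * g (R ^ i)))"
      by (rule X_law_integral) simp
    also have "\<dots> = (\<Sum>i\<in>{j..Suc N}. weight i * g (R ^ i))"
      using iff by (intro sum.mono_neutral_cong_right) (auto simp: indicator_def)
    finally show ?thesis .
  qed
  have "D.prob (consistent h) = (\<integral>x. indicator (consistent h) x * 1 \<partial>X_law)"
    by (simp add: sets_X_law)
  also have "\<dots> = tail j" using sum[of "\<lambda>_. 1"] sum_weight[OF j] by simp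
  finally show "cond_exp h g = (\<Sum>i\<in>{j..Suc N}. weight i * g (R ^ i)) / tail j"
    if "g \<in> borel_measurable borel" for g
    using cond_exp_eq[OF that] sum[OF that] by simp
qed

text \<open>For \<open>j = 0\<close> the \<open>N\<close> middle values contribute at least
  \<open>\<eta> / 2\<close> each. For \<open>1 <= j <= N\<close> the largest value alone contributes
  1, against \<open>tail j = \<eta> / R ^ j\<close>. For \<open>j = Suc N\<close> the mean is
  \<open>R ^ Suc N\<close>, and the exponent is capped at \<open>N\<close>, the last index with a
  slope bound.\<close>

lemma truncated_mean_ge:
  assumes "j \<le> Suc N"
  shows "6 * \<alpha> * R ^ min j N \<le> (\<Sum>i\<in>{j..Suc N}. weight i * R ^ i) / tail j"
proof -
  have T1: "1 \<le> (\<Sum>i\<in>{j..Suc N}. weight i * R ^ i)"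
  proof -
    have "(\<Sum>i\<in>{Suc N}. weight i * R ^ i) \<le> (\<Sum>i\<in>{j..Suc N}. weight i * R ^ i)"
      using assms weight_nonneg power_R(2) by (intro sum_mono2) (auto simp: less_imp_le)
    then show ?thesis using weight_last(1) by simp
  qed
  consider "j = 0" | "0 < j" "j \<le> N" | "j = Suc N" using assms by fastforce
  then show ?thesis
  proof cases
    case 1
    have "6 * \<alpha> \<le> (real N - 1) * (\<eta> / 2)"
    proof -
      have "72 * \<alpha>\<^sup>2 * (\<eta> / 2) \<le> (real N - 1) * (\<eta> / 2)" using N \<eta> by (intro mult_right_mono) auto
      moreover have "72 * \<alpha>\<^sup>2 * (\<eta> / 2) = 6 * \<alpha> * (6 * \<alpha> * \<eta>)" by (simp add: power2_eq_square)
      ultimately show ?thesis using \<eta>(3) by simp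
    qed
    also have "\<dots> \<le> real N * (\<eta> / 2)" using \<eta> by simp
    also have "\<dots> = (\<Sum>i\<in>{1..N}. \<eta> / 2)" by simp
    also have "\<dots> \<le> (\<Sum>i\<in>{1..N}. weight i * R ^ i)"
      using weight_power_ge by (intro sum_mono) auto
    also have "\<dots> \<le> (\<Sum>i\<in>{j..Suc N}. weight i * R ^ i)"
      using 1 weight_nonneg power_R(2) by (intro sum_mono2) (auto simp: less_imp_le)
    finally show ?thesis using 1 by (simp add: tail_def)
  next
    case 2
    have "6 * \<alpha> * R ^ j * tail j = 6 * \<alpha> * \<eta>" using 2 power_R(2)[of j] by (simp add: tail_def)
    then have "6 * \<alpha> * R ^ j * tail j \<le> (\<Sum>i\<in>{j..Suc N}. weight i * R ^ i)" using T1 \<eta>(3) by simp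
    then show ?thesis using 2 tail_pos[OF assms] by (simp add: pos_le_divide_eq)
  next
    case 3
    have "6 * \<alpha> * R ^ N \<le> R * R ^ N" using R power_R(2)[of N] by (intro mult_right_mono) auto
    moreover have "1 / tail (Suc N) = R * R ^ N" by (simp add: tail_def)
    ultimately show ?thesis using 3 weight_last by simp
  qed
qed

lemma no_pointwise_approximation:
  assumes \<pi>: "commitment (ws_mdp X_law 1) \<pi>"
  shows "\<not> pointwise_approximation \<alpha> (ws_mdp X_law 1) \<pi>"
proof
  assume approx: "pointwise_approximation \<alpha> (ws_mdp X_law 1) \<pi>"
  let ?C = "committed_chain (ws_mdp X_law 1) \<pi>" and ?M = "ws_mdp X_law 1"
  interpret C: bounded_chain ?C ws_state_space 1 by (rule commitment_bounded_chain[OF \<pi>])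
  \<comment> \<open>The factor 5 puts \<open>?y k\<close> above \<open>\<alpha>\<close> times the
    level \<open>4 * R ^ k\<close> fed to \<open>quantile_transfer\<close>; the factor 6 matches the
    bound on conditional means.\<close>
  let ?y = "\<lambda>k. 5 * \<alpha> * R ^ k" and ?z = "\<lambda>k. 6 * \<alpha> * R ^ k"
  let ?g = "indicator {R ^ Suc N} :: real \<Rightarrow> real"
  \<comment> \<open>For \<open>k < N\<close> this is the conditional probability of the largest
    value given \<open>X >= R ^ k\<close>. Index \<open>N\<close> serves both \<open>j = N\<close>
    and \<open>j = Suc N\<close>, so it gets the trivial bound 1.\<close>
  define w where "w k = (if k < N then tail (Suc N) / tail k else 1)" for k
  define b where "b k = (if k < N then tail (Suc k) else 0)" for k
  \<comment> \<open>The conditional probability of the largest value, a martingale along the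
    committed chain.\<close>
  define \<beta> where "\<beta> s = cond_exp (fst s) ?g" for s :: "history \<times> bool"
  have \<alpha>R: "0 < \<alpha> * R ^ k" for k using \<alpha> power_R(2)[of k] by simp
  have w0: "0 \<le> w k" for k
    using tail_pos[of "Suc N"] tail_pos[of k] by (auto simp: w_def intro!: divide_nonneg_nonneg)
  have g_int: "integrable X_law ?g" by (rule X_law_integral) simp
  have \<beta>_out: "\<beta> s = 0" if "R ^ Suc N \<notin> consistent (fst s)" for s
  proof -
    have "(\<lambda>x. indicator (consistent (fst s)) x * ?g x) = (\<lambda>x. 0)"
      using that by (auto simp: indicator_def fun_eq_iff)
    then show ?thesis unfolding \<beta>_def by (subst cond_exp_eq) simp_all
  qed
  have \<beta>_in: "\<exists>j\<le>Suc N. \<beta> s = tail (Suc N) / tail j \<and> 6 * \<alpha> * R ^ min j N \<le> cond_exp (fst s) (\<lambda>x. x)"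
    if top: "R ^ Suc N \<in> consistent (fst s)" for s
  proof -
    obtain j where j: "j \<le> Suc N" "\<And>g. g \<in> borel_measurable borel \<Longrightarrow>
        cond_exp (fst s) g = (\<Sum>i\<in>{j..Suc N}. weight i * g (R ^ i)) / tail j"
      using cond_exp_consistent[OF top] by blast
    have "(\<Sum>i\<in>{j..Suc N}. weight i * ?g (R ^ i)) = (\<Sum>i\<in>{Suc N}. weight i)"
    proof (intro sum.mono_neutral_cong_right)
      show "\<forall>i\<in>{j..Suc N} - {Suc N}. weight i * ?g (R ^ i) = 0"
      proof
        fix i assume "i \<in> {j..Suc N} - {Suc N}"
        then have "R ^ i \<noteq> R ^ Suc N" using power_le_iff[of "Suc N" i] by auto
        then show "weight i * ?g (R ^ i) = 0" by simp
      qed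
    qed (use j in auto)
    then have "\<beta> s = tail (Suc N) / tail j"
      unfolding \<beta>_def using j(2)[of ?g] weight_last by simp
    then show ?thesis using j truncated_mean_ge[OF j(1)] j(2)[of "\<lambda>x. x"] by auto
  qed
  have tail_last_le: "tail (Suc N) \<le> tail j" if "j \<le> Suc N" for j
    using sum_weight[OF that] sum_weight[of "Suc N"] weight_nonneg
      sum_mono2[of "{j..Suc N}" "{Suc N}" weight] that by simp
  have \<beta>01: "0 \<le> \<beta> s" "\<beta> s \<le> 1" for s
  proof -
    have "0 \<le> \<beta> s \<and> \<beta> s \<le> 1"
    proof (cases "R ^ Suc N \<in> consistent (fst s)")
      case True
      then obtain j where "j \<le> Suc N" "\<beta> s = tail (Suc N) / tail j" using \<beta>_in by blast
      then show ?thesis using tail_pos[of j] tail_pos[of "Suc N"] tail_last_le[of j] by simp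
    qed (simp add: \<beta>_out)
    then show "0 \<le> \<beta> s" "\<beta> s \<le> 1" by auto
  qed
  have "\<beta> (initial ?C) \<le> (\<Sum>k\<in>{..N}. w k * ((local_value ?C (?z k) - local_value ?C (?y k)) / (?z k - ?y k)))"
  proof (rule C.submartingale_le_local_value_slopes)
    have "w N \<le> (\<Sum>k\<in>{..N}. w k)" using w0 by (intro member_le_sum) auto
    moreover have "w N = 1" by (simp add: w_def)
    ultimately show "1 \<le> (\<Sum>k\<in>{..N}. w k)" by simp
    show "\<beta> \<in> borel_measurable ws_state_space" unfolding \<beta>_def by simp
    show "\<beta> s \<le> (\<integral>s'. \<beta> s' \<partial>trans ?C s ())" for s
    proof -
      have "\<bar>cond_exp h ?g\<bar> \<le> 1" for h using \<beta>01[of "(h, True)"] by (simp add: \<beta>_def)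
      from commitment_martingale[OF \<pi> g_int this] show ?thesis by (simp add: \<beta>_def)
    qed
    fix s assume "s \<in> terminal ?C"
    define v where "v = val ?C s"
    have v: "v = cond_exp (fst s) (\<lambda>x. x)" by (simp add: v_def)
    let ?d = "\<lambda>k. w k * ((min (?z k) v - min (?y k) v) / (?z k - ?y k))"
    have d0: "0 \<le> ?d k" for k using w0 \<alpha>R[of k] by (auto simp: min_def intro!: divide_nonneg_nonneg mult_nonneg_nonneg)
    have "\<beta> s \<le> (\<Sum>k\<in>{..N}. ?d k)"
    proof (cases "R ^ Suc N \<in> consistent (fst s)")
      case True
      then obtain j where j: "j \<le> Suc N" "\<beta> s = tail (Suc N) / tail j" "6 * \<alpha> * R ^ min j N \<le> v"
        using \<beta>_in v by blast
      let ?k = "min j N"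
      \<comment> \<open>An equality for \<open>j < N\<close>; otherwise the weight is 1.\<close>
      have "\<beta> s \<le> w ?k"
        using \<beta>01(2)[of s] j by (auto simp: w_def min_def)
      \<comment> \<open>The conditional mean is at least \<open>?z ?k\<close>, so both minima are
        the outside costs and the quotient is 1.\<close>
      also have "\<dots> = ?d ?k" using j(3) \<alpha> \<alpha>R[of ?k] by (simp add: min_absorb1)
      also have "\<dots> = (\<Sum>k\<in>{?k}. ?d k)" by simp
      also have "\<dots> \<le> (\<Sum>k\<in>{..N}. ?d k)" using d0 by (intro sum_mono2) auto
      finally show ?thesis .
    qed (use \<beta>_out d0 in \<open>simp add: sum_nonneg\<close>)
    then show "\<beta> s \<le> (\<Sum>k\<in>{..N}. w k * ((min (?z k) (val ?C s) - min (?y k) (val ?C s)) / (?z k - ?y k)))"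
      by (simp only: v_def)
  qed (use w0 \<beta>01 \<alpha>R in \<open>auto simp: less_imp_le\<close>)
  also have "\<dots> \<le> (\<Sum>k\<in>{..N}. w k * b k)"
  proof (intro sum_mono mult_left_mono w0)
    fix k assume k: "k \<in> {..N}"
    have "local_value ?C (?z k) - local_value ?C (?y k) \<le> (?z k - ?y k) * b k"
    proof (rule quantile_transfer[OF C.local_value_W_law local_value_W_law])
      show "\<forall>q\<in>{0..1}. quantile (W_law ?C) q \<le> ereal \<alpha> * quantile (W_law ?M) q"
        using approx by (simp add: pointwise_approximation_def)
      show "local_value ?M (4 * R ^ k) - local_value ?M (3 * R ^ k) \<le> (4 * R ^ k - 3 * R ^ k) * b k"
        using local_value_diff[of k] local_value_diff_top k by (cases "k < N") (auto simp: b_def)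
    qed (use \<alpha> \<alpha>R[of k] power_R(2)[of k] in auto)
    then show "(local_value ?C (?z k) - local_value ?C (?y k)) / (?z k - ?y k) \<le> b k"
      using \<alpha>R[of k] by (subst pos_divide_le_eq) (auto simp: mult.commute)
  qed
  \<comment> \<open>The term \<open>k = N\<close> vanishes because the top slope bound is 0.\<close>
  also have "\<dots> = (\<Sum>k\<in>{..<N}. w k * b k)"
    unfolding lessThan_Suc_atMost[symmetric] by (simp add: b_def)
  also have "\<dots> \<le> (\<Sum>k\<in>{..<N}. tail (Suc N) / R)"
  proof (rule sum_mono)
    fix k assume k: "k \<in> {..<N}"
    have "w k * b k \<le> tail (Suc N) / tail k * (tail k / R)"
      using k mult_left_mono[OF tail_Suc_le[of k] w0[of k]] by (simp add: w_def b_def)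
    then show "w k * b k \<le> tail (Suc N) / R" using tail_pos[of k] k by simp
  qed
  also have "\<dots> = tail (Suc N) * (real N / R)" by simp
  also have "\<dots> < tail (Suc N) * 1"
    using R tail_pos[of "Suc N"] by (intro mult_strict_left_mono) auto
  finally have "\<beta> (initial ?C) < tail (Suc N)" by simp
  \<comment> \<open>Since \<open>tail j <= 1\<close>, the initial value of \<open>\<beta>\<close> is
    at least \<open>tail (Suc N)\<close>, which contradicts the strict bound.\<close>
  moreover obtain j where "j \<le> Suc N" "\<beta> (initial ?C) = tail (Suc N) / tail j"
    using \<beta>_in[of "initial ?C"] by auto
  ultimately show False
    using tail_pos[of j] tail_pos[of "Suc N"] tail_le_1[of j] by (simp add: pos_divide_less_eq)
qed

end

theorem theorem8:
  fixes \<alpha> :: real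
  assumes "\<alpha> \<ge> 1"
  shows "\<exists>D c. ws_alternative D c \<and>
           \<not> (\<exists>\<pi>. commitment (ws_mdp D c) \<pi> \<and> pointwise_approximation \<alpha> (ws_mdp D c) \<pi>)"
proof -
  obtain N :: nat where "1 + 72 * \<alpha>\<^sup>2 \<le> real N" using real_arch_simple by blast
  then interpret hard_instance \<alpha> "4 * real N" "1 / (6 * \<alpha>)" N
    using assms by unfold_locales auto
  show ?thesis using alternative no_pointwise_approximation by blast
qed

end
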